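(* The class of almost unimodular groups is the smallest class of locally compact groups that is closed under extensions by discrete groups and that contains all unimodular groups.
   Context: Locally compact groups are Hausdorff. $\Delta_G\colon G\to\mathbb{R}_+=(0,\infty)$ is the modular function of a locally compact group $G$, $\mu_G(E\cdot s)=\Delta_G(s)\mu_G(E)$ for a left Haar measure $\mu_G$. $G$ is unimodular if $\Delta_G\equiv1$, and almost unimodular if $\ker\Delta_G$ is open in $G$. A class $\mathcal{C}$ of locally compact groups is closed under extensions by discrete groups if, whenever $1\to N\to G\to H\to1$ is a short exact sequence of locally compact groups (i.e. $N$ is a closed normal subgroup of $G$ and $H\cong G/N$ as topological groups) with $N\in\mathcal{C}$ and $H$ discrete, one has $G\in\mathcal{C}$. *)

theory Defs
  imports "HOL-Analysis.Analysis" "HOL-Algebra.Coset"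
begin

section \<open>Locally compact groups\<close>

record 'a top_group = "'a monoid" +
  gtop :: "'a topology"

definition topological_group :: "'a top_group \<Rightarrow> bool" where
  "topological_group G \<longleftrightarrow>
     group G \<and> topspace (gtop G) = carrier G \<and>
     continuous_map (prod_topology (gtop G) (gtop G)) (gtop G) (\<lambda>(x, y). x \<otimes>\<^bsub>G\<^esub> y) \<and>
     continuous_map (gtop G) (gtop G) (\<lambda>x. inv\<^bsub>G\<^esub> x)"

definition lc_group :: "'a top_group \<Rightarrow> bool" where
  "lc_group G \<longleftrightarrow>
     topological_group G \<and> Hausdorff_space (gtop G) \<and> locally_compact_space (gtop G)"

definition top_iso :: "'a top_group \<Rightarrow> 'b top_group \<Rightarrow> ('a \<Rightarrow> 'b) set" where
  "top_iso G H = {f \<in> iso G H. homeomorphic_map (gtop G) (gtop H) f}"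

definition top_subgroup :: "'a top_group \<Rightarrow> 'a set \<Rightarrow> 'a top_group" where
  "top_subgroup G K = G\<lparr>carrier := K, gtop := subtopology (gtop G) K\<rparr>"

definition coset_topology :: "'a top_group \<Rightarrow> 'a set \<Rightarrow> 'a set topology" where
  "coset_topology G K =
     topology (\<lambda>U. U \<subseteq> rcosets\<^bsub>G\<^esub> K \<and>
                   openin (gtop G) {x \<in> topspace (gtop G). K #>\<^bsub>G\<^esub> x \<in> U})"

lemma openin_coset_topology:
  "openin (coset_topology G K) U \<longleftrightarrow>
     U \<subseteq> rcosets\<^bsub>G\<^esub> K \<and> openin (gtop G) {x \<in> topspace (gtop G). K #>\<^bsub>G\<^esub> x \<in> U}"
proof -
  let ?pre = "\<lambda>U. {x \<in> topspace (gtop G). K #>\<^bsub>G\<^esub> x \<in> U}"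
  have Int: "?pre (S \<inter> T) = ?pre S \<inter> ?pre T" for S T
    by blast
  have Un: "?pre (\<Union>\<K>) = (\<Union>S\<in>\<K>. ?pre S)" for \<K>
    by blast
  have "istopology (\<lambda>U. U \<subseteq> rcosets\<^bsub>G\<^esub> K \<and> openin (gtop G) (?pre U))"
    unfolding istopology_def Int Un by (auto intro: openin_Int openin_Union)
  then show ?thesis
    unfolding coset_topology_def by (simp add: topology_inverse')
qed

definition top_quotient :: "'a top_group \<Rightarrow> 'a set \<Rightarrow> 'a set top_group" where
  "top_quotient G K =
     \<lparr>carrier = carrier (G Mod K), mult = mult (G Mod K), one = one (G Mod K),
      gtop = coset_topology G K\<rparr>"

section \<open>Haar measure and the modular function\<close>

text \<open>
  Haar measures are Radon measures on the Borel sets: finite on compact sets, outer regular on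
  Borel sets and inner regular on open sets.
\<close>

definition left_haar_measure :: "'a top_group \<Rightarrow> 'a measure \<Rightarrow> bool" where
  "left_haar_measure G \<mu> \<longleftrightarrow>
     space \<mu> = carrier G \<and>
     sets \<mu> = sigma_sets (carrier G) {U. openin (gtop G) U} \<and>
     emeasure \<mu> (carrier G) \<noteq> 0 \<and>
     (\<forall>K. compactin (gtop G) K \<longrightarrow> emeasure \<mu> K < \<infinity>) \<and>
     (\<forall>E\<in>sets \<mu>. emeasure \<mu> E = (INF U\<in>{U. openin (gtop G) U \<and> E \<subseteq> U}. emeasure \<mu> U)) \<and>
     (\<forall>U. openin (gtop G) U \<longrightarrow>
        emeasure \<mu> U = (SUP K\<in>{K. compactin (gtop G) K \<and> K \<subseteq> U}. emeasure \<mu> K)) \<and>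
     (\<forall>s\<in>carrier G. \<forall>E\<in>sets \<mu>. emeasure \<mu> (s <#\<^bsub>G\<^esub> E) = emeasure \<mu> E)"

text \<open>
  By existence and uniqueness (up to scaling) of left Haar measure, exactly one positive real
  number satisfies the description below when \<open>G\<close> is locally compact and \<open>s \<in> carrier G\<close>.
\<close>

definition modular_function :: "'a top_group \<Rightarrow> 'a \<Rightarrow> real" where
  "modular_function G s =
     (THE d. 0 < d \<and>
        (\<forall>\<mu>. left_haar_measure G \<mu> \<longrightarrow>
           (\<forall>E\<in>sets \<mu>. emeasure \<mu> (E #>\<^bsub>G\<^esub> s) = ennreal d * emeasure \<mu> E)))"

definition unimodular :: "'a top_group \<Rightarrow> bool" where
  "unimodular G \<longleftrightarrow> lc_group G \<and> (\<forall>s\<in>carrier G. modular_function G s = 1)"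

definition almost_unimodular :: "'a top_group \<Rightarrow> bool" where
  "almost_unimodular G \<longleftrightarrow>
     lc_group G \<and> openin (gtop G) {s \<in> carrier G. modular_function G s = 1}"

section \<open>Extensions by discrete groups\<close>

definition discrete_group :: "'a top_group \<Rightarrow> bool" where
  "discrete_group H \<longleftrightarrow> topological_group H \<and> gtop H = discrete_topology (carrier H)"

text \<open>
  A class of locally compact groups is represented by a set of groups whose underlying sets lie in
  an arbitrary type \<open>'a\<close>, which plays the role of the universe. Such a set is not required to be
  invariant under isomorphism.
\<close>

definition closed_under_discrete_extensions :: "'a top_group set \<Rightarrow> bool" where
  "closed_under_discrete_extensions \<C> \<longleftrightarrow>
     (\<forall>G K (H :: 'a top_group).
        lc_group G \<and> K \<lhd> G \<and> closedin (gtop G) K \<and>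
        lc_group H \<and> top_iso H (top_quotient G K) \<noteq> {} \<and>
        top_subgroup G K \<in> \<C> \<and> discrete_group H
        \<longrightarrow> G \<in> \<C>)"

end

theory Submission
  imports Defs
begin

text \<open>
  Write \<open>\<Delta>\<close> for the modular function of a group, and let \<open>K\<close> be an open subgroup of \<open>G\<close>.
  A left Haar measure of \<open>G\<close> restricted to \<open>K\<close> is a left Haar measure of \<open>K\<close>, because open
  and compact subsets of \<open>K\<close> are open and compact in \<open>G\<close> and a nonempty open set has positive
  measure. Hence the modular function of \<open>K\<close> is the restriction of that of \<open>G\<close>
  (\<open>modular_function_open_subgroup\<close>), and both halves of the theorem follow.

  If \<open>G / K\<close> is discrete, then \<open>K\<close> is open, being the preimage of a point. If moreover the
  kernel of \<open>\<Delta>\<close> on \<open>K\<close> is open in \<open>K\<close>, then it is open in \<open>G\<close>, and the kernel of \<open>\<Delta>\<close> on \<open>G\<close> is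
  a union of its translates. This is closure under discrete extensions.
  Conversely, if \<open>G\<close> is almost unimodular, the kernel \<open>N\<close> of \<open>\<Delta>\<close> is an open normal subgroup on
  which \<open>\<Delta>\<close> is constantly one; so \<open>N\<close> is unimodular, \<open>G / N\<close> is discrete, and \<open>G\<close> belongs to
  every class that contains the unimodular groups and is closed under discrete extensions. The
  quotient has to be realised by a group whose elements have the same type as those of \<open>G\<close>; coset
  representatives provide one.

  The modular function is the unique number that scales all left Haar measures at once, so these
  arguments say something only once Haar measure is known to exist and to be unique up to a
  factor. Both facts are proved here for arbitrary locally compact groups.

  Existence (\<open>haar_content.left_haar_measure_haar\<close>) follows Weil and Halmos. The number of translates
  of a small neighbourhood \<open>V\<close> of \<open>\<one>\<close> that are needed to cover a compact set, divided by the number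
  needed for a reference set, is nearly additive; a limit point for shrinking \<open>V\<close>, given by
  Tychonoff's theorem, is an invariant content on compact sets, which extends to a Radon measure by
  Caratheodory's theorem.

  Uniqueness (\<open>haar_measure_unique\<close>) rests on an identity for two left Haar measures \<open>M\<close> and \<open>N\<close> and
  functions \<open>f\<close>, \<open>g\<close> with compact support: the integral of \<open>f(x) g(y x)\<close> over \<open>M \<times> N\<close> is the product
  of the \<open>M\<close>-integral of \<open>g\<close> and the \<open>N\<close>-integral of \<open>f(inv y)\<close> (\<open>convolution_identity\<close>). Dividing \<open>f\<close>
  by the inner integral shows that the ratio of the integrals of \<open>f\<close> and \<open>g\<close> is the same for every \<open>M\<close>.
\<close>

text \<open>The symbol is needed for left cosets.\<close>

no_notation subset_mset (infix "<#" 50)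

section \<open>Topology of locally compact groups\<close>

locale locally_compact_group =
  fixes G :: "'a top_group" (structure)
  assumes lc_group: "lc_group G"
begin

sublocale group G
  using lc_group by (simp add: lc_group_def topological_group_def)

abbreviation T :: "'a topology" where "T \<equiv> gtop G"

lemma topspace_T [simp]: "topspace T = carrier G"
  and Hausdorff_T: "Hausdorff_space T"
  and locally_compact_T: "locally_compact_space T"
  and continuous_mult: "continuous_map (prod_topology T T) T (\<lambda>(x, y). x \<otimes> y)"
  and continuous_inv: "continuous_map T T (\<lambda>x. inv x)"
  using lc_group by (auto simp: lc_group_def topological_group_def)

lemma open_subset_carrier: "openin T U \<Longrightarrow> U \<subseteq> carrier G"
  using openin_subset by fastforce

lemma compact_subset_carrier: "compactin T K \<Longrightarrow> K \<subseteq> carrier G"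
  using compactin_subset_topspace by fastforce

lemma compact_imp_closed: "compactin T K \<Longrightarrow> closedin T K"
  by (simp add: Hausdorff_T compactin_imp_closedin)

lemma open_diff_compact: "openin T U \<Longrightarrow> compactin T K \<Longrightarrow> openin T (U - K)"
  by (simp add: compact_imp_closed openin_diff)

lemma compact_diff_open: "compactin T K \<Longrightarrow> openin T U \<Longrightarrow> compactin T (K - U)"
  by (metis Diff_subset closed_compactin closedin_diff compact_imp_closed)

lemma continuous_map_mult:
  "continuous_map X T f \<Longrightarrow> continuous_map X T g \<Longrightarrow> continuous_map X T (\<lambda>x. f x \<otimes> g x)"
  using continuous_map_compose[OF continuous_map_pairedI continuous_mult, of X f g] by (simp add: o_def)

lemma continuous_map_inv: "continuous_map X T f \<Longrightarrow> continuous_map X T (\<lambda>x. inv (f x))"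
  using continuous_map_compose[OF _ continuous_inv] by (auto simp: o_def)

lemma continuous_map_constant: "a \<in> carrier G \<Longrightarrow> continuous_map X T (\<lambda>x. a)"
  by simp

lemmas continuous_group_intros =
  continuous_map_mult continuous_map_inv continuous_map_constant
  continuous_map_fst continuous_map_snd continuous_map_id[unfolded id_def]

lemma homeomorphic_left_translation:
  assumes "a \<in> carrier G" shows "homeomorphic_map T T (\<lambda>x. a \<otimes> x)"
proof -
  have "homeomorphic_maps T T (\<lambda>x. a \<otimes> x) (\<lambda>x. inv a \<otimes> x)"
    using assms by (auto simp: homeomorphic_maps_def m_assoc[symmetric] intro!: continuous_group_intros)
  then show ?thesis by (auto simp: homeomorphic_map_maps)
qed

lemma homeomorphic_right_translation:
  assumes "a \<in> carrier G" shows "homeomorphic_map T T (\<lambda>x. x \<otimes> a)"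
proof -
  have "homeomorphic_maps T T (\<lambda>x. x \<otimes> a) (\<lambda>x. x \<otimes> inv a)"
    using assms by (auto simp: homeomorphic_maps_def m_assoc intro!: continuous_group_intros)
  then show ?thesis by (auto simp: homeomorphic_map_maps)
qed

lemma l_coset_image: "a <# U = (\<lambda>x. a \<otimes> x) ` U"
  by (auto simp: l_coset_def)

lemma r_coset_image: "U #> a = (\<lambda>x. x \<otimes> a) ` U"
  by (auto simp: r_coset_def)

lemma l_coset_iff:
  assumes "a \<in> carrier G" "U \<subseteq> carrier G" "x \<in> carrier G"
  shows "x \<in> a <# U \<longleftrightarrow> inv a \<otimes> x \<in> U"
proof
  assume "x \<in> a <# U"
  then obtain u where u: "u \<in> U" "x = a \<otimes> u" by (auto simp: l_coset_def)
  then have "u \<in> carrier G" using assms by blast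
  then show "inv a \<otimes> x \<in> U"
    using u assms by (simp add: m_assoc[symmetric])
next
  assume *: "inv a \<otimes> x \<in> U"
  have "x = a \<otimes> (inv a \<otimes> x)" using assms by (simp add: m_assoc[symmetric])
  with * show "x \<in> a <# U" unfolding l_coset_def by blast
qed

lemma r_coset_iff:
  assumes "a \<in> carrier G" "U \<subseteq> carrier G" "x \<in> carrier G"
  shows "x \<in> U #> a \<longleftrightarrow> x \<otimes> inv a \<in> U"
proof
  assume "x \<in> U #> a"
  then obtain u where u: "u \<in> U" "x = u \<otimes> a" by (auto simp: r_coset_def)
  then have "u \<in> carrier G" using assms by blast
  then show "x \<otimes> inv a \<in> U"
    using u assms by (simp add: m_assoc)
next
  assume *: "x \<otimes> inv a \<in> U"
  have "x = x \<otimes> inv a \<otimes> a" using assms by (simp add: m_assoc)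
  with * show "x \<in> U #> a" unfolding r_coset_def by blast
qed

lemma open_l_coset: "a \<in> carrier G \<Longrightarrow> openin T U \<Longrightarrow> openin T (a <# U)"
  using homeomorphic_map_openness[OF homeomorphic_left_translation] open_subset_carrier
  by (simp add: l_coset_image)

lemma open_r_coset: "a \<in> carrier G \<Longrightarrow> openin T U \<Longrightarrow> openin T (U #> a)"
  using homeomorphic_map_openness[OF homeomorphic_right_translation] open_subset_carrier
  by (simp add: r_coset_image)

lemma compact_l_coset: "a \<in> carrier G \<Longrightarrow> compactin T U \<Longrightarrow> compactin T (a <# U)"
  unfolding l_coset_image
  using homeomorphic_left_translation homeomorphic_imp_continuous_map image_compactin by blast

lemma compact_r_coset: "a \<in> carrier G \<Longrightarrow> compactin T U \<Longrightarrow> compactin T (U #> a)"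
  unfolding r_coset_image
  using homeomorphic_right_translation homeomorphic_imp_continuous_map image_compactin by blast

lemma l_coset_inv_cancel:
  assumes "a \<in> carrier G" "U \<subseteq> carrier G"
  shows "inv a <# (a <# U) = U" "a <# (inv a <# U) = U"
  using assms by (simp_all add: lcos_m_assoc lcos_mult_one)

lemma r_coset_inv_cancel:
  assumes "a \<in> carrier G" "U \<subseteq> carrier G"
  shows "(U #> a) #> inv a = U" "(U #> inv a) #> a = U"
  using assms by (simp_all add: coset_mult_assoc)

lemma l_coset_mono: "U \<subseteq> V \<Longrightarrow> a <# U \<subseteq> a <# V"
  by (auto simp: l_coset_def)

lemma r_coset_mono: "U \<subseteq> V \<Longrightarrow> U #> a \<subseteq> V #> a"
  by (auto simp: r_coset_def)

lemma compact_mult: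
  assumes "compactin T K" "compactin T L"
  shows "compactin T ((\<lambda>(x, y). x \<otimes> y) ` (K \<times> L))"
  using image_compactin[OF _ continuous_mult] assms by (simp add: compactin_Times)

lemma compact_inv: "compactin T K \<Longrightarrow> compactin T ((\<lambda>x. inv x) ` K)"
  using image_compactin[OF _ continuous_inv] by blast

lemma compact_in_open_in_compact:
  assumes "compactin T K"
  obtains U L where "openin T U" "compactin T L" "K \<subseteq> U" "U \<subseteq> L"
proof -
  have "\<forall>K. compactin T K \<longrightarrow> (\<exists>U L. openin T U \<and> compactin T L \<and> closedin T L \<and> K \<subseteq> U \<and> U \<subseteq> L)"
    using locally_compact_space_compact_closed_compact[of T] locally_compact_T Hausdorff_T by simp
  then show ?thesis using assms that by meson
qed

lemma separate_compact:
  assumes "compactin T K" "compactin T L" "K \<inter> L = {}"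
  obtains U V where "openin T U" "openin T V" "K \<subseteq> U" "L \<subseteq> V" "U \<inter> V = {}"
proof -
  have "disjnt K L" using assms(3) by (simp add: disjnt_def)
  then obtain U V where "openin T U" "openin T V" "K \<subseteq> U" "L \<subseteq> V" "disjnt U V"
    using Hausdorff_T[unfolded Hausdorff_space_compact_sets] assms(1,2) by metis
  then show ?thesis using that[of U V] by (simp add: disjnt_def)
qed

text \<open>
  The parts of \<open>K\<close> outside \<open>V\<close> and outside \<open>U\<close> are disjoint compact sets, so disjoint open sets \<open>P\<close> and
  \<open>Q\<close> separate them; removing \<open>Q\<close> and \<open>P\<close> from \<open>K\<close> gives the two pieces. This is what makes a content on
  compact sets subadditive on open sets.
\<close>

lemma compact_split:
  assumes K: "compactin T K" and "openin T U" "openin T V" "K \<subseteq> U \<union> V"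
  obtains K1 K2 where "compactin T K1" "compactin T K2" "K1 \<subseteq> U" "K2 \<subseteq> V" "K = K1 \<union> K2"
proof -
  have "compactin T (K - V)" "compactin T (K - U)" "(K - V) \<inter> (K - U) = {}"
    using assms compact_diff_open by auto
  then obtain P Q where "openin T P" "openin T Q" "K - V \<subseteq> P" "K - U \<subseteq> Q" "P \<inter> Q = {}"
    by (rule separate_compact)
  then have "K - Q \<subseteq> U" "K - P \<subseteq> V" "K = (K - Q) \<union> (K - P)" "compactin T (K - Q)" "compactin T (K - P)"
    using K compact_diff_open by auto
  then show ?thesis
    by (intro that[of "K - Q" "K - P"])
qed

lemma compact_neighbourhood_one:
  obtains U A where "openin T U" "compactin T A" "\<one> \<in> U" "U \<subseteq> A"
proof -
  have "compactin T {\<one>}" by (simp add: finite_imp_compactin)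
  then show ?thesis
    by (rule compact_in_open_in_compact) (use that in auto)
qed

text \<open>
  Urysohn's lemma with compact support. The function is made to vanish off the carrier as well, so
  that its bounds hold for all elements of the type.
\<close>

lemma bump_function:
  assumes K: "compactin T K" and U: "openin T U" and "K \<subseteq> U"
  obtains f :: "'a \<Rightarrow> real" and L where "continuous_map T euclideanreal f" "compactin T L" "L \<subseteq> carrier G"
    "\<And>x. 0 \<le> f x" "\<And>x. f x \<le> 1" "\<And>x. x \<in> K \<Longrightarrow> f x = 1" "\<And>x. x \<notin> U \<Longrightarrow> f x = 0" "\<And>x. x \<notin> L \<Longrightarrow> f x = 0"
proof -
  obtain W L where W: "openin T W" "compactin T L" "K \<subseteq> W" "W \<subseteq> L"
    using compact_in_open_in_compact[OF K] .
  have cr: "completely_regular_space T"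
    using locally_compact_regular_imp_completely_regular_space locally_compact_T Hausdorff_T by blast
  have "closedin T (carrier G - (U \<inter> W))"
    using U W by (metis closedin_diff closedin_topspace openin_Int topspace_T)
  moreover have "disjnt K (carrier G - (U \<inter> W))"
    using assms W by (auto simp: disjnt_def)
  ultimately obtain f where f: "continuous_map T (top_of_set {0..1::real}) f"
     "f ` K \<subseteq> {1}" "f ` (carrier G - (U \<inter> W)) \<subseteq> {0}"
    by (rule Urysohn_completely_regular_compact_closed[OF zero_le_one cr K])
  let ?g = "\<lambda>x. if x \<in> carrier G then f x else 0"
  have "continuous_map T euclideanreal f"
    using f(1) by (simp add: continuous_map_in_subtopology)
  then have cg: "continuous_map T euclideanreal ?g"
    by (rule continuous_map_eq) auto
  have rng: "f x \<in> {0..1}" if "x \<in> carrier G" for x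
    using f(1) that unfolding continuous_map_def by auto
  show ?thesis
  proof (rule that[of ?g L])
    show "continuous_map T euclideanreal ?g" by fact
    show "compactin T L" by fact
    show "L \<subseteq> carrier G" using W compact_subset_carrier by blast
    show "?g x = 1" if "x \<in> K" for x
      using f(2) that K compact_subset_carrier by auto
    show "?g x = 0" if "x \<notin> U" for x using f(3) that by auto
    show "?g x = 0" if "x \<notin> L" for x using f(3) that W by auto
  qed (use rng in auto)
qed

end

section \<open>Covering numbers and invariant contents\<close>

context locally_compact_group
begin

definition nbhd_one :: "'a set \<Rightarrow> bool" where
  "nbhd_one V \<longleftrightarrow> openin T V \<and> \<one> \<in> V"

text \<open>
  The index \<open>(K : V)\<close> of Haar: how many left translates of \<open>V\<close> are needed to cover \<open>K\<close>.
\<close>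

definition covering_number :: "'a set \<Rightarrow> 'a set \<Rightarrow> nat" where
  "covering_number K V =
     (LEAST n. \<exists>F. finite F \<and> F \<subseteq> carrier G \<and> card F = n \<and> K \<subseteq> (\<Union>a\<in>F. a <# V))"

lemma nbhd_one_subset: "nbhd_one V \<Longrightarrow> V \<subseteq> carrier G"
  by (simp add: nbhd_one_def open_subset_carrier)

lemma finite_translate_cover:
  assumes K: "compactin T K" and V: "openin T V" "v \<in> V"
  obtains F where "finite F" "F \<subseteq> carrier G" "K \<subseteq> (\<Union>a\<in>F. a <# V)"
proof -
  have v: "v \<in> carrier G" and Vc: "V \<subseteq> carrier G" using V open_subset_carrier by auto
  have "K \<subseteq> \<Union> ((\<lambda>x. (x \<otimes> inv v) <# V) ` K)"
  proof
    fix x assume x: "x \<in> K"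
    then have xc: "x \<in> carrier G" using K compact_subset_carrier by blast
    have "inv (x \<otimes> inv v) \<otimes> x = v"
      using xc v by (simp add: inv_mult_group m_assoc)
    then have "x \<in> (x \<otimes> inv v) <# V"
      using xc v Vc V by (simp add: l_coset_iff)
    then show "x \<in> \<Union> ((\<lambda>x. (x \<otimes> inv v) <# V) ` K)" using x by blast
  qed
  moreover have "openin T W" if "W \<in> (\<lambda>x. (x \<otimes> inv v) <# V) ` K" for W
    using that K compact_subset_carrier v V by (auto intro!: open_l_coset)
  ultimately obtain \<F> where \<F>: "finite \<F>" "\<F> \<subseteq> (\<lambda>x. (x \<otimes> inv v) <# V) ` K" "K \<subseteq> \<Union>\<F>"
    using compactinD[OF K] by meson
  then obtain C where C: "C \<subseteq> K" "finite C" "\<F> = (\<lambda>x. (x \<otimes> inv v) <# V) ` C"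
    by (meson finite_subset_image)
  show ?thesis
  proof (rule that[of "(\<lambda>x. x \<otimes> inv v) ` C"])
    show "(\<lambda>x. x \<otimes> inv v) ` C \<subseteq> carrier G"
      using C(1) K compact_subset_carrier v by blast
  qed (use C \<F> in auto)
qed

lemma covering_number_le:
  assumes "finite F" "F \<subseteq> carrier G" "K \<subseteq> (\<Union>a\<in>F. a <# V)"
  shows "covering_number K V \<le> card F"
  unfolding covering_number_def by (rule Least_le) (use assms in blast)

lemma covering_number_witness:
  assumes "compactin T K" "nbhd_one V"
  obtains F where "finite F" "F \<subseteq> carrier G" "card F = covering_number K V" "K \<subseteq> (\<Union>a\<in>F. a <# V)"
proof -
  obtain F where "finite F" "F \<subseteq> carrier G" "K \<subseteq> (\<Union>a\<in>F. a <# V)"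
    using finite_translate_cover[OF assms(1), of V \<one>] assms(2) unfolding nbhd_one_def by auto
  then have "\<exists>n F. finite F \<and> F \<subseteq> carrier G \<and> card F = n \<and> K \<subseteq> (\<Union>a\<in>F. a <# V)"
    by blast
  from LeastI_ex[OF this, folded covering_number_def]
  obtain F where "finite F \<and> F \<subseteq> carrier G \<and> card F = covering_number K V \<and> K \<subseteq> (\<Union>a\<in>F. a <# V)" ..
  then show ?thesis using that[of F] by simp
qed

lemma covering_number_mono:
  assumes "compactin T L" "nbhd_one V" "K \<subseteq> L"
  shows "covering_number K V \<le> covering_number L V"
proof -
  obtain F where F: "finite F" "F \<subseteq> carrier G" "card F = covering_number L V" "L \<subseteq> (\<Union>a\<in>F. a <# V)"
    by (rule covering_number_witness[OF assms(1,2)])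
  then have "K \<subseteq> (\<Union>a\<in>F. a <# V)" using assms(3) by blast
  then show ?thesis using covering_number_le[of F K V] F by simp
qed

lemma covering_number_pos:
  assumes "compactin T K" "nbhd_one V" "K \<noteq> {}"
  shows "0 < covering_number K V"
proof -
  obtain F where "finite F" "card F = covering_number K V" "K \<subseteq> (\<Union>a\<in>F. a <# V)"
    by (rule covering_number_witness[OF assms(1,2)])
  then show ?thesis using \<open>K \<noteq> {}\<close> by (metis UN_empty card_gt_0_iff subset_empty)
qed

lemma covering_number_Un_le:
  assumes "compactin T K" "compactin T L" "nbhd_one V"
  shows "covering_number (K \<union> L) V \<le> covering_number K V + covering_number L V"
proof -
  obtain F where F: "finite F" "F \<subseteq> carrier G" "card F = covering_number K V" "K \<subseteq> (\<Union>a\<in>F. a <# V)"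
    by (rule covering_number_witness[OF assms(1,3)])
  obtain F' where F': "finite F'" "F' \<subseteq> carrier G" "card F' = covering_number L V" "L \<subseteq> (\<Union>a\<in>F'. a <# V)"
    by (rule covering_number_witness[OF assms(2,3)])
  have "covering_number (K \<union> L) V \<le> card (F \<union> F')"
    by (rule covering_number_le) (use F F' in auto)
  also have "\<dots> \<le> card F + card F'" by (rule card_Un_le)
  finally show ?thesis using F F' by simp
qed

lemma covering_number_l_coset_le:
  assumes "compactin T K" "nbhd_one V" "s \<in> carrier G"
  shows "covering_number (s <# K) V \<le> covering_number K V"
proof -
  obtain F where F: "finite F" "F \<subseteq> carrier G" "card F = covering_number K V" "K \<subseteq> (\<Union>a\<in>F. a <# V)"
    by (rule covering_number_witness[OF assms(1,2)])
  have "s <# K \<subseteq> s <# (\<Union>a\<in>F. a <# V)" using F(4) by (rule l_coset_mono)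
  also have "\<dots> = (\<Union>a\<in>F. s <# (a <# V))" by (auto simp: l_coset_def)
  also have "\<dots> = (\<Union>a\<in>(\<lambda>a. s \<otimes> a) ` F. a <# V)"
    using F(2) assms nbhd_one_subset by (simp add: lcos_m_assoc subset_iff)
  finally have "covering_number (s <# K) V \<le> card ((\<lambda>a. s \<otimes> a) ` F)"
    by (intro covering_number_le) (use F assms in auto)
  also have "\<dots> \<le> card F" using F by (intro card_image_le)
  finally show ?thesis using F by simp
qed

lemma covering_number_l_coset:
  assumes "compactin T K" "nbhd_one V" "s \<in> carrier G"
  shows "covering_number (s <# K) V = covering_number K V"
proof (rule antisym)
  have "covering_number (inv s <# (s <# K)) V \<le> covering_number (s <# K) V"
    using assms by (intro covering_number_l_coset_le compact_l_coset) auto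
  then show "covering_number K V \<le> covering_number (s <# K) V"
    using assms by (simp add: l_coset_inv_cancel compact_subset_carrier)
qed (rule covering_number_l_coset_le[OF assms])

text \<open>
  Cover \<open>K\<close> by translates of \<open>U\<close> and each of these by translates of \<open>V\<close>. The factor \<open>(K : U)\<close> does not
  depend on \<open>V\<close>, so the quotients \<open>(K : V) / (A : V)\<close> stay bounded while \<open>V\<close> shrinks.
\<close>

lemma covering_number_submult:
  assumes "compactin T K" "compactin T A" "nbhd_one U" "U \<subseteq> A" "nbhd_one V"
  shows "covering_number K V \<le> covering_number K U * covering_number A V"
proof -
  obtain F where F: "finite F" "F \<subseteq> carrier G" "card F = covering_number K U" "K \<subseteq> (\<Union>a\<in>F. a <# U)"
    by (rule covering_number_witness[OF assms(1,3)])
  obtain F' where F': "finite F'" "F' \<subseteq> carrier G" "card F' = covering_number A V" "A \<subseteq> (\<Union>a\<in>F'. a <# V)"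
    by (rule covering_number_witness[OF assms(2,5)])
  have "K \<subseteq> (\<Union>a\<in>(\<lambda>(a, b). a \<otimes> b) ` (F \<times> F'). a <# V)"
  proof
    fix x assume "x \<in> K"
    then obtain a where a: "a \<in> F" "x \<in> a <# U" using F by blast
    then have "x \<in> a <# (\<Union>b\<in>F'. b <# V)"
      using l_coset_mono[of U "\<Union>b\<in>F'. b <# V" a] assms(4) F'(4) by blast
    then obtain b where b: "b \<in> F'" "x \<in> a <# (b <# V)" by (auto simp: l_coset_def)
    then have "x \<in> (a \<otimes> b) <# V"
      using a b F F' nbhd_one_subset[OF assms(5)] lcos_m_assoc[of V a b] by blast
    then show "x \<in> (\<Union>a\<in>(\<lambda>(a, b). a \<otimes> b) ` (F \<times> F'). a <# V)" using a b by force
  qed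
  then have "covering_number K V \<le> card ((\<lambda>(a, b). a \<otimes> b) ` (F \<times> F'))"
    by (intro covering_number_le) (use F F' in auto)
  also have "\<dots> \<le> card (F \<times> F')" using F F' by (intro card_image_le) auto
  finally show ?thesis using F F' by (simp add: card_cartesian_product)
qed

text \<open>
  A translate that meets one of the sets is useless for covering the other, so a minimal cover of
  the union splits into two disjoint covers.
\<close>

lemma covering_number_Un_eq:
  assumes KL: "compactin T K" "compactin T L" "nbhd_one V"
    and sep: "\<And>a. a \<in> carrier G \<Longrightarrow> (a <# V) \<inter> K = {} \<or> (a <# V) \<inter> L = {}"
  shows "covering_number (K \<union> L) V = covering_number K V + covering_number L V"
proof (rule antisym)
  obtain F where F: "finite F" "F \<subseteq> carrier G" "card F = covering_number (K \<union> L) V"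
    "K \<union> L \<subseteq> (\<Union>a\<in>F. a <# V)"
    by (rule covering_number_witness[OF compactin_Un[OF KL(1,2)] KL(3)])
  define FK where "FK = {a \<in> F. (a <# V) \<inter> K \<noteq> {}}"
  define FL where "FL = {a \<in> F. (a <# V) \<inter> L \<noteq> {}}"
  have "K \<subseteq> (\<Union>a\<in>FK. a <# V)"
    using F(4) by (force simp: FK_def subset_iff)
  with F have "covering_number K V \<le> card FK"
    by (intro covering_number_le) (auto simp: FK_def)
  moreover have "L \<subseteq> (\<Union>a\<in>FL. a <# V)"
    using F(4) by (force simp: FL_def subset_iff)
  with F have "covering_number L V \<le> card FL"
    by (intro covering_number_le) (auto simp: FL_def)
  moreover have "card FK + card FL = card (FK \<union> FL)"
    using F sep by (intro card_Un_disjoint[symmetric]) (auto simp: FK_def FL_def)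
  moreover have "card (FK \<union> FL) \<le> card F"
    using F by (intro card_mono) (auto simp: FK_def FL_def)
  ultimately show "covering_number K V + covering_number L V \<le> covering_number (K \<union> L) V"
    using F by linarith
qed (rule covering_number_Un_le[OF KL])

text \<open>
  A translate \<open>a <# V\<close> meeting both sets produces \<open>k = a \<otimes> v\<close> and \<open>l = a \<otimes> w\<close> with
  \<open>inv k \<otimes> l = inv v \<otimes> w\<close>. The elements on the left form a compact set that misses \<open>\<one>\<close>, hence small
  \<open>v\<close> and \<open>w\<close> cannot satisfy this equation.
\<close>

lemma separating_nbhd_one:
  assumes K: "compactin T K" and L: "compactin T L" and "K \<inter> L = {}"
  obtains V where "nbhd_one V"
    "\<And>a. a \<in> carrier G \<Longrightarrow> (a <# V) \<inter> K = {} \<or> (a <# V) \<inter> L = {}"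
proof -
  have Kc: "K \<subseteq> carrier G" and Lc: "L \<subseteq> carrier G" using K L compact_subset_carrier by auto
  define C where "C = (\<lambda>(x, y). x \<otimes> y) ` (((\<lambda>x. inv x) ` K) \<times> L)"
  have C: "compactin T C" unfolding C_def by (intro compact_mult compact_inv K L)
  have "\<one> \<notin> C"
  proof
    assume "\<one> \<in> C"
    then obtain k l where kl: "k \<in> K" "l \<in> L" "\<one> = inv k \<otimes> l" by (auto simp: C_def)
    then have "k = l" using Kc Lc by (metis inv_equality inv_inv inv_closed subsetD)
    then show False using kl assms(3) by blast
  qed
  define O' where "O' = carrier G - C"
  have O': "openin T O'" unfolding O'_def using C compact_imp_closed topspace_T by (metis openin_diff openin_topspace)
  define W where "W = {p \<in> topspace (prod_topology T T). inv (fst p) \<otimes> snd p \<in> O'}"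
  have "continuous_map (prod_topology T T) T (\<lambda>p. inv (fst p) \<otimes> snd p)"
    by (intro continuous_group_intros)
  then have W: "openin (prod_topology T T) W"
    unfolding W_def using O' openin_continuous_map_preimage by blast
  have "(\<one>, \<one>) \<in> W" using \<open>\<one> \<notin> C\<close> by (simp add: W_def O'_def)
  then obtain U V where UV: "openin T U" "openin T V" "\<one> \<in> U" "\<one> \<in> V" "U \<times> V \<subseteq> W"
    using W unfolding openin_prod_topology_alt by meson
  show ?thesis
  proof (rule that[of "U \<inter> V"])
    show "nbhd_one (U \<inter> V)" using UV by (auto simp: nbhd_one_def)
    fix a assume a: "a \<in> carrier G"
    show "(a <# (U \<inter> V)) \<inter> K = {} \<or> (a <# (U \<inter> V)) \<inter> L = {}"
    proof (rule ccontr)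
      assume "\<not> ?thesis"
      then obtain v w where vw: "v \<in> U \<inter> V" "w \<in> U \<inter> V" "a \<otimes> v \<in> K" "a \<otimes> w \<in> L"
        by (auto simp: l_coset_def)
      then have c: "v \<in> carrier G" "w \<in> carrier G" using UV open_subset_carrier by auto
      have e: "inv a \<otimes> (a \<otimes> w) = w" using a c by (simp add: m_assoc[symmetric])
      have "inv (a \<otimes> v) \<otimes> (a \<otimes> w) = inv v \<otimes> (inv a \<otimes> (a \<otimes> w))"
        using a c by (simp add: inv_mult_group m_assoc)
      then have "inv (a \<otimes> v) \<otimes> (a \<otimes> w) = inv v \<otimes> w" unfolding e .
      moreover have "inv (a \<otimes> v) \<otimes> (a \<otimes> w) \<in> C" using vw by (force simp: C_def)
      moreover have "inv v \<otimes> w \<in> O'" using UV(5) vw by (auto simp: W_def)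
      ultimately show False by (simp add: O'_def)
    qed
  qed
qed

end

text \<open>
  The properties of the limit of covering ratios from which Haar measure is built.
\<close>

locale haar_content = locally_compact_group G for G :: "'a top_group" (structure) +
  fixes c :: "'a set \<Rightarrow> real"
  assumes content_nonneg: "compactin T K \<Longrightarrow> 0 \<le> c K"
    and content_mono: "compactin T K \<Longrightarrow> compactin T L \<Longrightarrow> K \<subseteq> L \<Longrightarrow> c K \<le> c L"
    and content_Un_le: "compactin T K \<Longrightarrow> compactin T L \<Longrightarrow> c (K \<union> L) \<le> c K + c L"
    and content_Un_eq: "compactin T K \<Longrightarrow> compactin T L \<Longrightarrow> K \<inter> L = {} \<Longrightarrow> c (K \<union> L) = c K + c L"
    and content_l_coset: "compactin T K \<Longrightarrow> s \<in> carrier G \<Longrightarrow> c (s <# K) = c K"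
    and content_nontrivial: "\<exists>A. compactin T A \<and> 0 < c A"

context locally_compact_group
begin

definition shrinking_nbhds :: "'a set filter" where
  "shrinking_nbhds = (INF V\<in>Collect nbhd_one. principal {W. nbhd_one W \<and> W \<subseteq> V})"

lemma nbhd_one_Int: "nbhd_one U \<Longrightarrow> nbhd_one V \<Longrightarrow> nbhd_one (U \<inter> V)"
  by (auto simp: nbhd_one_def)

lemma nbhd_one_carrier: "nbhd_one (carrier G)"
  unfolding nbhd_one_def by (metis one_closed openin_topspace topspace_T)

lemma eventually_shrinking_nbhds:
  "eventually P shrinking_nbhds \<longleftrightarrow> (\<exists>V. nbhd_one V \<and> (\<forall>W. nbhd_one W \<longrightarrow> W \<subseteq> V \<longrightarrow> P W))"
proof -
  have "eventually P shrinking_nbhds \<longleftrightarrow>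
      (\<exists>V\<in>Collect nbhd_one. eventually P (principal {W. nbhd_one W \<and> W \<subseteq> V}))"
    unfolding shrinking_nbhds_def
  proof (rule eventually_INF_base)
    show "Collect nbhd_one \<noteq> {}" using nbhd_one_carrier by blast
    fix U V assume "U \<in> Collect nbhd_one" "V \<in> Collect nbhd_one"
    then show "\<exists>x\<in>Collect nbhd_one. principal {W. nbhd_one W \<and> W \<subseteq> x}
        \<le> inf (principal {W. nbhd_one W \<and> W \<subseteq> U}) (principal {W. nbhd_one W \<and> W \<subseteq> V})"
      by (intro bexI[of _ "U \<inter> V"]) (auto intro: nbhd_one_Int)
  qed
  then show ?thesis by (auto simp: eventually_principal)
qed

text \<open>
  Each covering ratio is a point of a product of compact intervals, one factor for each set \<open>K\<close>. By
  Tychonoff's theorem these points accumulate at some \<open>c\<close> as the neighbourhood shrinks. A cluster point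
  is a limit along a finer filter \<open>H\<close>, and along \<open>H\<close> the inequalities between covering numbers pass
  to \<open>c\<close> by the ordinary limit laws.
\<close>

lemma haar_content_exists: "\<exists>c. haar_content G c"
proof -
  obtain U0 A0 where UA: "openin T U0" "compactin T A0" "\<one> \<in> U0" "U0 \<subseteq> A0"
    by (rule compact_neighbourhood_one)
  then have U0: "nbhd_one U0" and A0: "A0 \<noteq> {}" by (auto simp: nbhd_one_def)
  define r where "r W K = (if compactin T K
      then real (covering_number K W) / real (covering_number A0 W) else 0)" for W K
  define b where "b K = (if compactin T K then real (covering_number K U0) else 0)" for K
  define S where "S = PiE UNIV (\<lambda>K. {0..b K})"
  have "compactin (product_topology (\<lambda>i. euclideanreal) UNIV) S"
    unfolding S_def by (subst compactin_PiE) auto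
  then have "compact S"
    by (simp add: euclidean_product_topology)
  have pos: "0 < real (covering_number A0 W)" if "nbhd_one W" for W
    using covering_number_pos[OF UA(2) that A0] by simp
  have rS: "r W \<in> S" if W: "nbhd_one W" for W
  proof -
    have "r W K \<in> {0..b K}" for K
    proof (cases "compactin T K")
      case True
      have "covering_number K W \<le> covering_number K U0 * covering_number A0 W"
        using covering_number_submult[OF True UA(2) U0 UA(4) W] .
      then have "real (covering_number K W) \<le> real (covering_number K U0) * real (covering_number A0 W)"
        by (metis of_nat_le_iff of_nat_mult)
      then show ?thesis using pos[OF W] True by (simp add: r_def b_def divide_le_eq)
    qed (simp add: r_def b_def)
    then show ?thesis by (auto simp: S_def)
  qed
  let ?F = "shrinking_nbhds"
  have Fbot: "?F \<noteq> bot"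
    unfolding trivial_limit_def eventually_shrinking_nbhds using nbhd_one_carrier by blast
  have evF: "eventually P ?F" if "\<And>W. nbhd_one W \<Longrightarrow> P W" for P
    unfolding eventually_shrinking_nbhds using that nbhd_one_carrier by blast
  have "filtermap r ?F \<noteq> bot" using Fbot by (simp add: filtermap_bot_iff)
  moreover have "eventually (\<lambda>f. f \<in> S) (filtermap r ?F)"
    unfolding eventually_filtermap by (rule evF) (rule rS)
  ultimately obtain c where c: "c \<in> S" "inf (nhds c) (filtermap r ?F) \<noteq> bot"
    using \<open>compact S\<close> unfolding compact_filter by blast
  \<comment> \<open>The filter that makes the cluster point a limit.\<close>
  define H where "H = inf (filtercomap r (nhds c)) ?F"
  have Hbot: "H \<noteq> bot"
  proof
    assume "H = bot"
    then have "eventually (\<lambda>x. False) H" by simp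
    then obtain P Q where PQ: "eventually P (filtercomap r (nhds c))" "eventually Q ?F" "\<And>x. P x \<Longrightarrow> Q x \<Longrightarrow> False"
      unfolding H_def eventually_inf by blast
    then obtain P' where P': "eventually P' (nhds c)" "\<And>x. P' (r x) \<Longrightarrow> P x"
      unfolding eventually_filtercomap by blast
    have "eventually (\<lambda>y. \<exists>x. Q x \<and> y = r x) (filtermap r ?F)"
      unfolding eventually_filtermap using PQ(2) by (rule eventually_mono) blast
    then have "eventually (\<lambda>x. False) (inf (nhds c) (filtermap r ?F))"
      unfolding eventually_inf using P' PQ(3) by blast
    then show False using c(2) by (simp add: trivial_limit_def)
  qed
  have evH: "eventually P H" if "eventually P ?F" for P
    using that unfolding H_def by (rule filter_leD[OF inf_le2])
  have evH': "eventually P H" if "\<And>W. nbhd_one W \<Longrightarrow> P W" for P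
    using that by (intro evH evF)
  have "(r \<longlongrightarrow> c) H"
    unfolding H_def using filterlim_filtercomap[of r "nhds c"] by (rule filterlim_mono) auto
  then have lim: "((\<lambda>W. r W K) \<longlongrightarrow> c K) H" for K
    using continuous_on_tendsto_compose[OF continuous_on_product_coordinates[of K], of r c H] by simp
  have "haar_content G c"
  proof (unfold_locales)
    fix K L assume K: "compactin T K" and L: "compactin T L"
    then have KL: "compactin T (K \<union> L)" by (rule compactin_Un)
    show "0 \<le> c K" using c(1) by (auto simp: S_def)
    show "c K \<le> c L" if "K \<subseteq> L"
    proof (rule tendsto_le[OF Hbot lim lim evH'])
      fix W assume W: "nbhd_one W"
      show "r W K \<le> r W L"
        using covering_number_mono[OF L W that] K L by (simp add: r_def divide_right_mono)
    qed
    show "c (K \<union> L) \<le> c K + c L"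
    proof (rule tendsto_le[OF Hbot tendsto_add[OF lim lim] lim evH'])
      fix W assume W: "nbhd_one W"
      show "r W (K \<union> L) \<le> r W K + r W L"
        using covering_number_Un_le[OF K L W] K L KL
        by (simp add: r_def add_divide_distrib[symmetric] divide_right_mono)
    qed
    show "c (K \<union> L) = c K + c L" if "K \<inter> L = {}"
    proof (rule tendsto_unique[OF Hbot lim])
      \<comment> \<open>Inside a separating neighbourhood the covering numbers are exactly additive.\<close>
      obtain V where V: "nbhd_one V" "\<And>a. a \<in> carrier G \<Longrightarrow> (a <# V) \<inter> K = {} \<or> (a <# V) \<inter> L = {}"
        using separating_nbhd_one[OF K L \<open>K \<inter> L = {}\<close>] by metis
      have "r W (K \<union> L) = r W K + r W L" if W: "nbhd_one W" "W \<subseteq> V" for W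
      proof -
        have "(a <# W) \<inter> K = {} \<or> (a <# W) \<inter> L = {}" if "a \<in> carrier G" for a
          using V(2)[OF that] l_coset_mono[OF W(2), of a] by blast
        then show ?thesis
          using covering_number_Un_eq[OF K L W(1)] K L KL by (simp add: r_def add_divide_distrib)
      qed
      then have "eventually (\<lambda>W. r W K + r W L = r W (K \<union> L)) ?F"
        unfolding eventually_shrinking_nbhds using V(1) by metis
      then have "eventually (\<lambda>W. r W K + r W L = r W (K \<union> L)) H" by (rule evH)
      then show "((\<lambda>W. r W (K \<union> L)) \<longlongrightarrow> c K + c L) H"
        by (rule Lim_transform_eventually[OF tendsto_add[OF lim lim]])
    qed
    show "c (s <# K) = c K" if s: "s \<in> carrier G" for s
    proof (rule tendsto_unique[OF Hbot lim])
      have "eventually (\<lambda>W. r W K = r W (s <# K)) H"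
        by (rule evH') (use K s in \<open>simp add: r_def covering_number_l_coset compact_l_coset\<close>)
      then show "((\<lambda>W. r W (s <# K)) \<longlongrightarrow> c K) H"
        by (rule Lim_transform_eventually[OF lim])
    qed
  next
    have "c A0 = 1"
    proof (rule tendsto_unique[OF Hbot lim tendsto_eventually])
      show "eventually (\<lambda>W. r W A0 = 1) H"
        by (rule evH') (use pos UA(2) in \<open>force simp: r_def\<close>)
    qed
    then show "\<exists>A. compactin T A \<and> 0 < c A" using UA(2) by (metis zero_less_one)
  qed
  then show ?thesis by (rule exI[where x = c])
qed

end

section \<open>Existence of Haar measure\<close>

context locally_compact_group
begin

abbreviation borel_sets :: "'a set set" where
  "borel_sets \<equiv> sigma_sets (carrier G) {U. openin T U}"

lemma opens_Pow: "{U. openin T U} \<subseteq> Pow (carrier G)"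
  using open_subset_carrier by auto

lemma borel_subset_carrier: "E \<in> borel_sets \<Longrightarrow> E \<subseteq> carrier G"
  by (rule sigma_sets_into_sp[OF opens_Pow])

lemma open_carrier: "openin T (carrier G)"
  by (metis openin_topspace topspace_T)

lemma open_imp_borel: "openin T U \<Longrightarrow> U \<in> borel_sets"
  by blast

lemma compact_imp_borel:
  assumes "compactin T K" shows "K \<in> borel_sets"
proof -
  have "carrier G - (carrier G - K) \<in> borel_sets"
    by (intro sigma_sets.Compl open_imp_borel open_diff_compact open_carrier assms)
  moreover have "carrier G - (carrier G - K) = K" using compact_subset_carrier[OF assms] by blast
  ultimately show ?thesis by simp
qed

text \<open>
  Induction over the generation of the Borel sets; injectivity is what lets images commute with
  complements.
\<close>

lemma borel_homeomorphic_image: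
  assumes h: "homeomorphic_map T T h" and "E \<in> borel_sets"
  shows "h ` E \<in> borel_sets"
  using assms(2)
proof induction
  case (Basic U)
  then show ?case
    using h homeomorphic_map_openness open_subset_carrier by (metis mem_Collect_eq open_imp_borel topspace_T)
next
  case (Compl E)
  have inj: "inj_on h (carrier G)" and surj: "h ` carrier G = carrier G"
    using h by (auto simp: homeomorphic_eq_everything_map)
  have "h ` (carrier G - E) = carrier G - h ` E"
    using inj_on_image_set_diff[OF inj, of "carrier G" E] surj borel_subset_carrier[OF Compl(1)] by simp
  then show ?case using Compl by (simp add: sigma_sets.Compl)
next
  case (Union E)
  then show ?case by (simp add: image_UN sigma_sets.Union)
qed (auto intro: sigma_sets.Empty)

lemma borel_l_coset: "s \<in> carrier G \<Longrightarrow> E \<in> borel_sets \<Longrightarrow> s <# E \<in> borel_sets"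
  unfolding l_coset_image by (intro borel_homeomorphic_image homeomorphic_left_translation)

lemma borel_r_coset: "s \<in> carrier G \<Longrightarrow> E \<in> borel_sets \<Longrightarrow> E #> s \<in> borel_sets"
  unfolding r_coset_image by (intro borel_homeomorphic_image homeomorphic_right_translation)

end

context haar_content
begin

text \<open>
  The content is extended first to open sets from inside, then to all sets from outside.
\<close>

definition open_measure :: "'a set \<Rightarrow> ennreal" where
  "open_measure U = (SUP K\<in>{K. compactin T K \<and> K \<subseteq> U}. ennreal (c K))"

definition outer_haar :: "'a set \<Rightarrow> ennreal" where
  "outer_haar E = (INF U\<in>{U. openin T U \<and> E \<subseteq> U}. open_measure U)"

lemma content_empty: "c {} = 0"
  using content_Un_eq[of "{}" "{}"] by simp

lemma open_measure_upper: "compactin T K \<Longrightarrow> K \<subseteq> U \<Longrightarrow> ennreal (c K) \<le> open_measure U"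
  unfolding open_measure_def by (intro SUP_upper) auto

lemma open_measure_least:
  "(\<And>K. compactin T K \<Longrightarrow> K \<subseteq> U \<Longrightarrow> ennreal (c K) \<le> d) \<Longrightarrow> open_measure U \<le> d"
  unfolding open_measure_def by (intro SUP_least) auto

lemma open_measure_mono: "U \<subseteq> V \<Longrightarrow> open_measure U \<le> open_measure V"
  by (rule open_measure_least) (auto intro: open_measure_upper)

lemma open_measure_empty: "open_measure {} = 0"
  using open_measure_least[of "{}" 0] content_empty by force

lemma open_measure_Un:
  assumes "openin T U" "openin T V"
  shows "open_measure (U \<union> V) \<le> open_measure U + open_measure V"
proof (rule open_measure_least)
  fix K assume K: "compactin T K" "K \<subseteq> U \<union> V"
  obtain K1 K2 where K12: "compactin T K1" "compactin T K2" "K1 \<subseteq> U" "K2 \<subseteq> V" "K = K1 \<union> K2"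
    by (rule compact_split[OF K(1) assms K(2)])
  have "ennreal (c K) \<le> ennreal (c K1 + c K2)"
    using content_Un_le K12 by (intro ennreal_leI) auto
  also have "\<dots> = ennreal (c K1) + ennreal (c K2)"
    using content_nonneg K12 by (intro ennreal_plus) auto
  also have "\<dots> \<le> open_measure U + open_measure V"
    using K12 by (intro add_mono open_measure_upper)
  finally show "ennreal (c K) \<le> open_measure U + open_measure V" .
qed

lemma open_measure_UN_lessThan:
  fixes n :: nat
  assumes "\<And>i. openin T (U i)"
  shows "open_measure (\<Union>i<n. U i) \<le> (\<Sum>i<n. open_measure (U i))"
proof (induction n)
  case (Suc n)
  have "open_measure (\<Union>i<Suc n. U i) = open_measure ((\<Union>i<n. U i) \<union> U n)"
    by (simp add: lessThan_Suc Un_commute)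
  also have "\<dots> \<le> open_measure (\<Union>i<n. U i) + open_measure (U n)"
    using assms by (intro open_measure_Un openin_Union) auto
  also have "\<dots> \<le> (\<Sum>i<Suc n. open_measure (U i))"
    using Suc by (simp add: add_right_mono)
  finally show ?case .
qed (simp add: open_measure_empty)

lemma open_measure_UN:
  assumes U: "\<And>i::nat. openin T (U i)"
  shows "open_measure (\<Union>i. U i) \<le> (\<Sum>i. open_measure (U i))"
proof (rule open_measure_least)
  fix K assume K: "compactin T K" "K \<subseteq> (\<Union>i. U i)"
  then obtain \<F> where \<F>: "finite \<F>" "\<F> \<subseteq> range U" "K \<subseteq> \<Union>\<F>"
    using compactinD[OF K(1), of "range U"] U by auto
  then obtain I where I: "finite I" "\<F> = U ` I" by (meson finite_subset_image)
  obtain n where n: "I \<subseteq> {..<n}" using finite_nat_bounded[OF I(1)] by blast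
  have "ennreal (c K) \<le> open_measure (\<Union>i<n. U i)"
    by (rule open_measure_upper[OF K(1)]) (use \<F> I n in blast)
  also have "\<dots> \<le> (\<Sum>i<n. open_measure (U i))" using U by (rule open_measure_UN_lessThan)
  also have "\<dots> \<le> (\<Sum>i. open_measure (U i))" by (intro sum_le_suminf) auto
  finally show "ennreal (c K) \<le> (\<Sum>i. open_measure (U i))" .
qed

lemma outer_haar_open: "openin T U \<Longrightarrow> outer_haar U = open_measure U"
  unfolding outer_haar_def
  by (intro antisym INF_greatest INF_lower) (auto intro: open_measure_mono)

lemma outer_haar_mono: "E \<subseteq> F \<Longrightarrow> outer_haar E \<le> outer_haar F"
  unfolding outer_haar_def by (rule INF_superset_mono) auto

lemma outer_haar_le: "openin T U \<Longrightarrow> E \<subseteq> U \<Longrightarrow> outer_haar E \<le> open_measure U"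
  unfolding outer_haar_def by (intro INF_lower) auto

lemma outer_haar_approx:
  assumes "outer_haar E < d"
  obtains U where "openin T U" "E \<subseteq> U" "open_measure U < d"
  using assms unfolding outer_haar_def INF_less_iff by blast

text \<open>
  Approximate each set from outside by an open set with an error of \<open>e / 2 ^ (i + 1)\<close>.
\<close>

lemma outer_haar_UN_le:
  fixes A :: "nat \<Rightarrow> 'a set"
  shows "outer_haar (\<Union>i. A i) \<le> (\<Sum>i. outer_haar (A i))"
proof (rule ennreal_le_epsilon)
  fix e :: real assume e: "0 < e" and fin: "(\<Sum>i. outer_haar (A i)) < Orderings.top"
  have "\<exists>U. openin T U \<and> A i \<subseteq> U \<and> open_measure U \<le> outer_haar (A i) + ennreal (e * (1/2) ^ Suc i)" for i
  proof -
    have "outer_haar (A i) < Orderings.top"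
      using fin by (metis ennreal_suminf_lessD)
    then have "outer_haar (A i) < outer_haar (A i) + ennreal (e * (1/2) ^ Suc i)"
      using e ennreal_add_left_cancel_less[of "outer_haar (A i)" 0 "ennreal (e * (1/2) ^ Suc i)"]
      by (simp add: less_top)
    then show ?thesis by (meson outer_haar_approx less_imp_le)
  qed
  then obtain U where U: "\<And>i. openin T (U i)" "\<And>i. A i \<subseteq> U i"
     "\<And>i. open_measure (U i) \<le> outer_haar (A i) + ennreal (e * (1/2) ^ Suc i)"
    by metis
  have "outer_haar (\<Union>i. A i) \<le> open_measure (\<Union>i. U i)"
    using U by (intro outer_haar_le openin_Union) auto
  also have "\<dots> \<le> (\<Sum>i. open_measure (U i))" using U(1) by (rule open_measure_UN)
  also have "\<dots> \<le> (\<Sum>i. outer_haar (A i) + ennreal (e * (1/2) ^ Suc i))"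
    using U(3) by (intro suminf_le) auto
  also have "\<dots> = (\<Sum>i. outer_haar (A i)) + (\<Sum>i. ennreal (e * (1/2) ^ Suc i))"
    by (intro suminf_add[symmetric]) auto
  also have "(\<Sum>i. ennreal (e * (1/2) ^ Suc i)) = ennreal e"
    using e sums_mult[OF power_half_series, of e]
    by (intro suminf_ennreal_eq) (auto simp del: power_Suc)
  finally show "outer_haar (\<Union>i. A i) \<le> (\<Sum>i. outer_haar (A i)) + ennreal e" .
qed

lemma outer_haar_empty: "outer_haar {} = 0"
  using outer_haar_open[of "{}"] open_measure_empty by simp

lemma outer_haar_Un: "outer_haar (A \<union> B) \<le> outer_haar A + outer_haar B"
proof -
  have "(\<Union>i. binaryset A B i) = A \<union> B" by (rule UN_binaryset_eq)
  then have "outer_haar (A \<union> B) \<le> (\<Sum>i. outer_haar (binaryset A B i))"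
    by (metis outer_haar_UN_le)
  also have "\<dots> = outer_haar A + outer_haar B"
    using outer_haar_empty by (intro suminf_binaryset_eq)
  finally show ?thesis .
qed

lemma outer_measure_space_outer_haar: "outer_measure_space (Pow (carrier G)) outer_haar"
  unfolding outer_measure_space_def positive_def increasing_def countably_subadditive_def
  using outer_haar_empty outer_haar_mono outer_haar_UN_le by auto

text \<open>
  The Caratheodory inequality, tested on an open set \<open>P\<close>. For a compact \<open>K \<subseteq> P \<inter> U\<close> the set \<open>P - K\<close> is
  still open, so any compact \<open>L\<close> inside it is disjoint from \<open>K\<close> and the contents of \<open>K\<close> and \<open>L\<close> add up
  within \<open>P\<close>. Taking suprema over \<open>L\<close> and then over \<open>K\<close> gives the claim.
\<close>

lemma open_measure_Diff_le:
  assumes O': "openin T P" and U: "openin T U"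
  shows "outer_haar (P \<inter> U) + outer_haar (P - U) \<le> open_measure P"
proof -
  have PU: "openin T (P \<inter> U)" using assms by (rule openin_Int)
  have *: "ennreal (c K) + outer_haar (P - U) \<le> open_measure P"
    if K: "compactin T K" "K \<subseteq> P \<inter> U" for K
  proof -
    have PK: "openin T (P - K)" using O' K by (intro open_diff_compact)
    have "outer_haar (P - U) \<le> open_measure (P - K)"
      using K PK by (intro outer_haar_le) auto
    moreover have "ennreal (c K) + open_measure (P - K) \<le> open_measure P"
    proof -
      have "ennreal (c K) + ennreal (c L) \<le> open_measure P" if L: "compactin T L" "L \<subseteq> P - K" for L
      proof -
        have "K \<inter> L = {}" using L by blast
        then have "ennreal (c K) + ennreal (c L) = ennreal (c (K \<union> L))"
          using content_Un_eq[of K L] content_nonneg K L by (subst ennreal_plus[symmetric]) auto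
        also have "\<dots> \<le> open_measure P"
          using K L by (intro open_measure_upper compactin_Un) auto
        finally show ?thesis .
      qed
      then have "(SUP L\<in>{L. compactin T L \<and> L \<subseteq> P - K}. ennreal (c L) + ennreal (c K)) \<le> open_measure P"
        by (intro SUP_least) (auto simp: add.commute)
      moreover have "{L. compactin T L \<and> L \<subseteq> P - K} \<noteq> {}" using compactin_empty by blast
      ultimately show ?thesis
        unfolding open_measure_def[of "P - K"] by (simp add: ennreal_SUP_add_left add.commute)
    qed
    ultimately show ?thesis by (meson add_left_mono order_trans)
  qed
  have "(SUP K\<in>{K. compactin T K \<and> K \<subseteq> P \<inter> U}. ennreal (c K) + outer_haar (P - U)) \<le> open_measure P"
    using * by (intro SUP_least) auto
  moreover have "{K. compactin T K \<and> K \<subseteq> P \<inter> U} \<noteq> {}" using compactin_empty by blast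
  ultimately show ?thesis
    using outer_haar_open[OF PU] unfolding open_measure_def[of "P \<inter> U"]
    by (simp add: ennreal_SUP_add_left)
qed

lemma open_in_lambda_system:
  assumes U: "openin T U"
  shows "U \<in> lambda_system (carrier G) (Pow (carrier G)) outer_haar"
proof -
  have "outer_haar (U \<inter> E) + outer_haar ((carrier G - U) \<inter> E) = outer_haar E"
    if E: "E \<subseteq> carrier G" for E
  proof (rule antisym)
    have "outer_haar (E \<inter> U) + outer_haar (E - U) \<le> open_measure P" if P: "openin T P" "E \<subseteq> P" for P
    proof -
      have "outer_haar (E \<inter> U) + outer_haar (E - U) \<le> outer_haar (P \<inter> U) + outer_haar (P - U)"
        using P by (intro add_mono outer_haar_mono) auto
      also have "\<dots> \<le> open_measure P" using P U by (intro open_measure_Diff_le)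
      finally show ?thesis .
    qed
    then have "outer_haar (E \<inter> U) + outer_haar (E - U) \<le> outer_haar E"
      unfolding outer_haar_def[of E] by (intro INF_greatest) auto
    moreover have "U \<inter> E = E \<inter> U" "(carrier G - U) \<inter> E = E - U" using E by auto
    ultimately show "outer_haar (U \<inter> E) + outer_haar ((carrier G - U) \<inter> E) \<le> outer_haar E"
      by simp
    have "(U \<inter> E) \<union> ((carrier G - U) \<inter> E) = E" using E by auto
    then show "outer_haar E \<le> outer_haar (U \<inter> E) + outer_haar ((carrier G - U) \<inter> E)"
      using outer_haar_Un[of "U \<inter> E" "(carrier G - U) \<inter> E"] by simp
  qed
  then show ?thesis
    using U open_subset_carrier by (auto simp: lambda_system_def)
qed

definition haar :: "'a measure" where
  "haar = measure_of (carrier G) {U. openin T U} outer_haar"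

lemma emeasure_haar:
  assumes "E \<in> borel_sets"
  shows "emeasure haar E = outer_haar E"
proof -
  let ?L = "lambda_system (carrier G) (Pow (carrier G)) outer_haar"
  interpret P: sigma_algebra "carrier G" "Pow (carrier G)" by (rule sigma_algebra_Pow)
  have ms: "measure_space (carrier G) ?L outer_haar"
    using P.caratheodory_lemma[OF outer_measure_space_outer_haar] .
  then interpret L: sigma_algebra "carrier G" ?L by (simp add: measure_space_def)
  have sub: "borel_sets \<subseteq> ?L"
    using open_in_lambda_system by (intro L.sigma_sets_subset) auto
  have sets: "sets haar = borel_sets"
    unfolding haar_def by (rule sets_measure_of[OF opens_Pow])
  have "positive (sets haar) outer_haar"
    using outer_haar_empty by (simp add: positive_def)
  moreover have "countably_additive (sets haar) outer_haar"
    using ms sub unfolding sets measure_space_def countably_additive_def by blast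
  ultimately show ?thesis
    using assms by (intro emeasure_measure_of[OF haar_def opens_Pow]) (auto simp: sets)
qed

lemma open_measure_l_coset:
  assumes s: "s \<in> carrier G" and U: "U \<subseteq> carrier G"
  shows "open_measure (s <# U) = open_measure U"
proof -
  have le: "open_measure V \<le> open_measure (t <# V)" if t: "t \<in> carrier G" for t V
  proof (rule open_measure_least)
    fix K assume K: "compactin T K" "K \<subseteq> V"
    have "ennreal (c K) = ennreal (c (t <# K))" using K t by (simp add: content_l_coset)
    also have "\<dots> \<le> open_measure (t <# V)"
      using K t by (intro open_measure_upper compact_l_coset l_coset_mono)
    finally show "ennreal (c K) \<le> open_measure (t <# V)" .
  qed
  show ?thesis
    using le[of s U] le[of "inv s" "s <# U"] s U by (simp add: l_coset_inv_cancel)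
qed

lemma outer_haar_l_coset:
  assumes s: "s \<in> carrier G" and E: "E \<subseteq> carrier G"
  shows "outer_haar (s <# E) = outer_haar E"
proof -
  have le: "outer_haar (t <# F) \<le> outer_haar F" if t: "t \<in> carrier G" for t F
    unfolding outer_haar_def[of F]
  proof (rule INF_greatest)
    fix U assume U: "U \<in> {U. openin T U \<and> F \<subseteq> U}"
    then have "outer_haar (t <# F) \<le> open_measure (t <# U)"
      using t by (intro outer_haar_le open_l_coset l_coset_mono) auto
    also have "\<dots> = open_measure U"
      using U t open_subset_carrier by (intro open_measure_l_coset) auto
    finally show "outer_haar (t <# F) \<le> open_measure U" .
  qed
  show ?thesis
    using le[of s E] le[of "inv s" "s <# E"] s E by (simp add: l_coset_inv_cancel)
qed

text \<open>
  Outer regularity holds by construction. Inner regularity on open sets and finiteness on compact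
  sets both come from comparing with the content: \<open>c K\<close> is at most the measure of \<open>K\<close>, which in turn is at
  most \<open>c L\<close> for a compact neighbourhood \<open>L\<close> of \<open>K\<close>.
\<close>

lemma left_haar_measure_haar: "left_haar_measure G haar"
proof -
  have sets: "sets haar = borel_sets"
    unfolding haar_def by (rule sets_measure_of[OF opens_Pow])
  have c_le: "ennreal (c K) \<le> outer_haar K" if "compactin T K" for K
    unfolding outer_haar_def using that by (intro INF_greatest open_measure_upper) auto
  have "emeasure haar (carrier G) \<noteq> 0"
  proof -
    obtain A where A: "compactin T A" "0 < c A" using content_nontrivial by blast
    then have "ennreal (c A) \<le> open_measure (carrier G)"
      by (intro open_measure_upper compact_subset_carrier)
    moreover have "0 < ennreal (c A)" using A by simp
    ultimately show ?thesis
      using emeasure_haar[OF open_imp_borel[OF open_carrier]] outer_haar_open[OF open_carrier] by auto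
  qed
  moreover have "emeasure haar K < \<infinity>" if K: "compactin T K" for K
  proof -
    obtain U L where UL: "openin T U" "compactin T L" "K \<subseteq> U" "U \<subseteq> L"
      by (rule compact_in_open_in_compact[OF K])
    have "outer_haar K \<le> open_measure U" using UL by (intro outer_haar_le)
    also have "\<dots> \<le> ennreal (c L)"
      using UL content_mono by (intro open_measure_least ennreal_leI) auto
    also have "\<dots> < \<infinity>" by simp
    finally show ?thesis using emeasure_haar[OF compact_imp_borel[OF K]] by simp
  qed
  moreover have "emeasure haar E = (INF U\<in>{U. openin T U \<and> E \<subseteq> U}. emeasure haar U)"
    if E: "E \<in> sets haar" for E
  proof -
    have "(INF U\<in>{U. openin T U \<and> E \<subseteq> U}. emeasure haar U) = (INF U\<in>{U. openin T U \<and> E \<subseteq> U}. open_measure U)"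
      by (intro INF_cong) (auto simp: emeasure_haar[OF open_imp_borel] outer_haar_open)
    then show ?thesis using emeasure_haar E unfolding sets outer_haar_def by simp
  qed
  moreover have "emeasure haar U = (SUP K\<in>{K. compactin T K \<and> K \<subseteq> U}. emeasure haar K)"
    if U: "openin T U" for U
  proof (rule antisym)
    have "emeasure haar U = open_measure U"
      using emeasure_haar[OF open_imp_borel[OF U]] outer_haar_open[OF U] by simp
    also have "\<dots> \<le> (SUP K\<in>{K. compactin T K \<and> K \<subseteq> U}. emeasure haar K)"
      unfolding open_measure_def
      by (rule SUP_mono) (use c_le emeasure_haar compact_imp_borel in force)
    finally show "emeasure haar U \<le> (SUP K\<in>{K. compactin T K \<and> K \<subseteq> U}. emeasure haar K)" .
    show "(SUP K\<in>{K. compactin T K \<and> K \<subseteq> U}. emeasure haar K) \<le> emeasure haar U"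
      using open_imp_borel[OF U] by (intro SUP_least emeasure_mono) (auto simp: sets)
  qed
  moreover have "emeasure haar (s <# E) = emeasure haar E"
    if s: "s \<in> carrier G" and E: "E \<in> sets haar" for s E
  proof -
    have Ec: "E \<subseteq> carrier G" using E sets borel_subset_carrier by blast
    have "s <# E \<in> borel_sets" using E s by (simp add: sets borel_l_coset)
    then show ?thesis using E emeasure_haar outer_haar_l_coset[OF s Ec] by (simp add: sets)
  qed
  ultimately show ?thesis
    unfolding left_haar_measure_def using sets opens_Pow
    by (auto simp: haar_def space_measure_of)
qed

end

section \<open>Interchanging integrals of continuous functions\<close>

lemma finite_measure_density_indicator:
  assumes A: "A \<in> sets M" and fin: "emeasure M A < \<infinity>"
  shows "finite_measure (density M (indicator A))"
proof (rule finite_measureI)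
  have "emeasure (density M (indicator A)) (space M) = (\<integral>\<^sup>+x. indicator A x * indicator (space M) x \<partial>M)"
    using A by (subst emeasure_density) auto
  also have "\<dots> = (\<integral>\<^sup>+x. indicator A x \<partial>M)"
    by (intro nn_integral_cong) auto
  also have "\<dots> = emeasure M A" using A by simp
  finally show "emeasure (density M (indicator A)) (space (density M (indicator A))) \<noteq> \<infinity>"
    using fin by simp
qed

context locally_compact_group
begin

lemma
  assumes "left_haar_measure G M"
  shows haar_space: "space M = carrier G"
    and haar_sets: "sets M = borel_sets"
    and haar_nonzero: "emeasure M (carrier G) \<noteq> 0"
    and haar_compact: "compactin T K \<Longrightarrow> emeasure M K < \<infinity>"
    and haar_outer: "E \<in> borel_sets \<Longrightarrow>
          emeasure M E = (INF U\<in>{U. openin T U \<and> E \<subseteq> U}. emeasure M U)"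
    and haar_inner: "openin T U \<Longrightarrow>
          emeasure M U = (SUP K\<in>{K. compactin T K \<and> K \<subseteq> U}. emeasure M K)"
    and haar_l_coset: "s \<in> carrier G \<Longrightarrow> E \<in> borel_sets \<Longrightarrow> emeasure M (s <# E) = emeasure M E"
proof -
  note D = assms[unfolded left_haar_measure_def]
  note D2 = conjunct2[OF D]
  note D3 = conjunct2[OF D2]
  note D4 = conjunct2[OF D3]
  note D5 = conjunct2[OF D4]
  note D6 = conjunct2[OF D5]
  show "space M = carrier G" by (rule conjunct1[OF D])
  show sM: "sets M = borel_sets" by (rule conjunct1[OF D2])
  show "emeasure M (carrier G) \<noteq> 0" by (rule conjunct1[OF D3])
  show "compactin T K \<Longrightarrow> emeasure M K < \<infinity>" by (rule conjunct1[OF D4, rule_format])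
  show "E \<in> borel_sets \<Longrightarrow> emeasure M E = (INF U\<in>{U. openin T U \<and> E \<subseteq> U}. emeasure M U)"
    by (rule conjunct1[OF D5, unfolded sM, rule_format])
  show "openin T U \<Longrightarrow> emeasure M U = (SUP K\<in>{K. compactin T K \<and> K \<subseteq> U}. emeasure M K)"
    by (rule conjunct1[OF D6, rule_format])
  show "s \<in> carrier G \<Longrightarrow> E \<in> borel_sets \<Longrightarrow> emeasure M (s <# E) = emeasure M E"
    by (rule conjunct2[OF D6, unfolded sM, rule_format])
qed

text \<open>
  If a nonempty open set were null, so would be every compact set, being covered by finitely many of
  its translates, and by inner regularity the whole group.
\<close>

lemma haar_open_nonzero:
  assumes M: "left_haar_measure G M" and U: "openin T U" "U \<noteq> {}"
  shows "emeasure M U \<noteq> 0"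
proof
  assume 0: "emeasure M U = 0"
  obtain u where u: "u \<in> U" using U by blast
  have "emeasure M K = 0" if K: "compactin T K" for K
  proof -
    obtain F where F: "finite F" "F \<subseteq> carrier G" "K \<subseteq> (\<Union>a\<in>F. a <# U)"
      by (rule finite_translate_cover[OF K U(1) u])
    have sub: "(\<lambda>a. a <# U) ` F \<subseteq> sets M"
      using F(2) U by (auto simp: haar_sets[OF M] intro!: borel_l_coset)
    have "emeasure M K \<le> emeasure M (\<Union>a\<in>F. a <# U)"
      using F sub by (intro emeasure_mono) auto
    also have "\<dots> \<le> (\<Sum>a\<in>F. emeasure M (a <# U))"
      using F sub by (intro emeasure_subadditive_finite)
    also have "\<dots> = 0"
      using F(2) U by (intro sum.neutral) (auto simp: haar_l_coset[OF M] 0 subset_iff)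
    finally show ?thesis by simp
  qed
  then have "emeasure M (carrier G) \<le> 0"
    unfolding haar_inner[OF M open_carrier] by (intro SUP_least) auto
  then show False using haar_nonzero[OF M] by simp
qed

lemma measurable_continuous_map:
  assumes "sets M = borel_sets" "space M = carrier G" "sets N = borel_sets" "continuous_map T T h"
  shows "h \<in> measurable M N"
proof (rule measurable_sigma_sets[OF assms(3) opens_Pow])
  show "h \<in> space M \<rightarrow> carrier G"
    using assms(2,4) by (auto simp: continuous_map_def)
  fix U assume "U \<in> {U. openin T U}"
  then have "openin T U" by simp
  then have "openin T {x \<in> carrier G. h x \<in> U}"
    using openin_continuous_map_preimage[OF assms(4)] by (simp only: topspace_T)
  moreover have "h -` U \<inter> space M = {x \<in> carrier G. h x \<in> U}" using assms(2) by auto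
  ultimately show "h -` U \<inter> space M \<in> sets M" using assms(1) open_imp_borel by metis
qed

lemma borel_measurable_continuous_map:
  assumes "sets M = borel_sets" "space M = carrier G" "continuous_map T euclideanreal f"
  shows "f \<in> borel_measurable M"
proof (rule borel_measurableI)
  fix S :: "real set" assume "open S"
  then have "openin T {x \<in> carrier G. f x \<in> S}"
    using openin_continuous_map_preimage[OF assms(3)] by (simp only: topspace_T open_openin)
  moreover have "f -` S \<inter> space M = {x \<in> carrier G. f x \<in> S}" using assms(2) by auto
  ultimately show "f -` S \<inter> space M \<in> sets M" using assms(1) open_imp_borel by metis
qed

lemma nn_integral_left_translate:
  assumes M: "left_haar_measure G M" and s: "s \<in> carrier G" and f: "f \<in> borel_measurable M"
  shows "(\<integral>\<^sup>+x. f (s \<otimes> x) \<partial>M) = (\<integral>\<^sup>+x. f x \<partial>M)"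
proof -
  have h: "(\<lambda>x. s \<otimes> x) \<in> measurable M M"
    using homeomorphic_imp_continuous_map[OF homeomorphic_left_translation[OF s]]
    by (intro measurable_continuous_map) (auto simp: haar_sets[OF M] haar_space[OF M])
  have "distr M M (\<lambda>x. s \<otimes> x) = M"
  proof (rule measure_eqI)
    fix E assume "E \<in> sets (distr M M (\<lambda>x. s \<otimes> x))"
    then have E: "E \<in> borel_sets" by (simp add: haar_sets[OF M])
    have "(\<lambda>x. s \<otimes> x) -` E \<inter> space M = inv s <# E"
    proof
      show "(\<lambda>x. s \<otimes> x) -` E \<inter> space M \<subseteq> inv s <# E"
        using s borel_subset_carrier[OF E] by (auto simp: haar_space[OF M] l_coset_iff)
      show "inv s <# E \<subseteq> (\<lambda>x. s \<otimes> x) -` E \<inter> space M"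
        using s borel_subset_carrier[OF E]
        by (auto simp: haar_space[OF M] l_coset_def m_assoc[symmetric] subset_iff)
    qed
    then show "emeasure (distr M M (\<lambda>x. s \<otimes> x)) E = emeasure M E"
      using h E s by (simp add: emeasure_distr haar_sets[OF M] haar_l_coset[OF M])
  qed simp
  then have "(\<integral>\<^sup>+x. f x \<partial>M) = (\<integral>\<^sup>+x. f x \<partial>distr M M (\<lambda>x. s \<otimes> x))" by simp
  also have "\<dots> = (\<integral>\<^sup>+x. f (s \<otimes> x) \<partial>M)" using h f by (simp add: nn_integral_distr)
  finally show ?thesis by simp
qed

text \<open>
  The tube lemma, applied to the open set where \<open>F\<close> differs by less than \<open>e\<close> from its value over \<open>x0\<close>. It
  replaces uniform continuity in the measurability and continuity arguments below.
\<close>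

lemma uniformly_near:
  assumes F: "continuous_map (prod_topology T T) euclideanreal F"
    and B: "compactin T B" and x0: "x0 \<in> carrier G" and e: "0 < e"
  obtains U where "openin T U" "x0 \<in> U" "\<And>x y. x \<in> U \<Longrightarrow> y \<in> B \<Longrightarrow> \<bar>F (x, y) - F (x0, y)\<bar> < e"
proof -
  have "continuous_map (prod_topology T T) (prod_topology T T) (\<lambda>p. (x0, snd p))"
    using x0 by (intro continuous_map_pairedI continuous_group_intros)
  then have "continuous_map (prod_topology T T) euclideanreal (\<lambda>p. F (x0, snd p))"
    using F continuous_map_compose[of _ _ "\<lambda>p. (x0, snd p)" _ F] by (simp add: o_def)
  then have "continuous_map (prod_topology T T) euclideanreal (\<lambda>p. \<bar>F p - F (x0, snd p)\<bar>)"
    using F by (intro continuous_intros)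
  then have "openin (prod_topology T T)
      {p \<in> topspace (prod_topology T T). \<bar>F p - F (x0, snd p)\<bar> \<in> {..<e}}" (is "openin _ ?W")
    by (rule openin_continuous_map_preimage) (simp add: open_openin[symmetric])
  moreover have sub: "{x0} \<times> B \<subseteq> ?W" using x0 e compact_subset_carrier[OF B] by auto
  moreover have x0': "compactin T {x0}" using x0 by (simp add: finite_imp_compactin)
  ultimately obtain U V where UV: "openin T U" "openin T V" "{x0} \<subseteq> U" "B \<subseteq> V" "U \<times> V \<subseteq> ?W"
    using Wallace_theorem_prod_topology[OF x0' B, of ?W] by blast
  show ?thesis
  proof (rule that[OF UV(1)])
    show "x0 \<in> U" using UV(3) by simp
    fix x y assume "x \<in> U" "y \<in> B"
    then have "(x, y) \<in> ?W" using UV(4,5) by blast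
    then show "\<bar>F (x, y) - F (x0, y)\<bar> < e" by simp
  qed
qed

lemma continuous_map_section:
  assumes F: "continuous_map (prod_topology T T) euclideanreal F" and x: "x \<in> carrier G"
  shows "continuous_map T euclideanreal (\<lambda>y. F (x, y))"
proof -
  have "continuous_map T (prod_topology T T) (\<lambda>y. (x, y))"
    using x by (intro continuous_map_pairedI continuous_group_intros)
  then show ?thesis
    using continuous_map_compose[OF _ F] by (auto simp: o_def)
qed

text \<open>
  Without a countable base the Borel sets of the square need not lie in the product \<open>\<sigma>\<close>-algebra, so
  measurability of a continuous \<open>F\<close> is not automatic. Compact support saves it: finitely many tubes cover
  \<open>A\<close>, and replacing \<open>x\<close> by the base point \<open>a (i x)\<close> of the first tube containing it approximates \<open>F\<close> uniformly by
  functions that are measurable for the product.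
\<close>

lemma borel_measurable_pair_continuous:
  assumes sM: "sets M = borel_sets" "space M = carrier G"
    and sN: "sets N = borel_sets" "space N = carrier G"
    and F: "continuous_map (prod_topology T T) euclideanreal F"
    and A: "compactin T A" and B: "compactin T B"
    and supp: "\<And>x y. x \<in> carrier G \<Longrightarrow> y \<in> carrier G \<Longrightarrow> x \<notin> A \<or> y \<notin> B \<Longrightarrow> F (x, y) = 0"
  shows "F \<in> borel_measurable (M \<Otimes>\<^sub>M N)"
proof -
  have Ac: "A \<subseteq> carrier G" using compact_subset_carrier[OF A] .
  have "\<exists>H. H \<in> borel_measurable (M \<Otimes>\<^sub>M N) \<and>
          (\<forall>p\<in>carrier G \<times> carrier G. \<bar>H p - F p\<bar> < inverse (Suc n))" for n
  proof -
    have "\<exists>U. openin T U \<and> x \<in> U \<and> (\<forall>z\<in>U. \<forall>y\<in>B. \<bar>F (z, y) - F (x, y)\<bar> < inverse (Suc n))"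
      if x: "x \<in> A" for x
    proof -
      have "x \<in> carrier G" "0 < inverse (real (Suc n))" using x Ac by auto
      from uniformly_near[OF F B this] show ?thesis by metis
    qed
    then obtain U where U: "\<And>x. x \<in> A \<Longrightarrow> openin T (U x)" "\<And>x. x \<in> A \<Longrightarrow> x \<in> U x"
        "\<And>x z y. x \<in> A \<Longrightarrow> z \<in> U x \<Longrightarrow> y \<in> B \<Longrightarrow> \<bar>F (z, y) - F (x, y)\<bar> < inverse (Suc n)"
      by metis
    obtain \<F> where \<F>: "finite \<F>" "\<F> \<subseteq> U ` A" "A \<subseteq> \<Union>\<F>"
      using compactinD[OF A, of "U ` A"] U(1,2) by fastforce
    then obtain C where C: "C \<subseteq> A" "finite C" "\<F> = U ` C" by (meson finite_subset_image)
    obtain xs where xs: "set xs = C" using finite_list[OF C(2)] by blast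
    define a where "a i = (if i < length xs then xs ! i else \<one>)" for i
    define V where "V i = (if i < length xs then U (xs ! i) else {})" for i
    have xsA: "xs ! i \<in> A" if "i < length xs" for i using xs C(1) nth_mem[OF that] by blast
    have a: "a i \<in> carrier G" for i using xsA Ac by (simp add: a_def subset_iff)
    have V: "openin T (V i)" for i using xsA U(1) by (simp add: V_def)
    have Vm[measurable]: "V i \<in> sets M" for i unfolding sM(1) by (rule open_imp_borel[OF V])
    have Am[measurable]: "A \<in> sets M" using compact_imp_borel[OF A] sM by simp
    \<comment> \<open>The first tube containing the point; a measurable choice with countably many values.\<close>
    define i where "i x = (LEAST i. x \<in> V i)" for x
    have i: "x \<in> V (i x)" if "x \<in> A" for x
    proof -
      have "x \<in> \<Union>(U ` C)" using that \<F>(3) unfolding C(3) by (rule subsetD[rotated])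
      then obtain c where c: "c \<in> C" "x \<in> U c" by (rule UN_E)
      then obtain j where "j < length xs" "xs ! j = c" unfolding xs[symmetric] by (metis in_set_conv_nth)
      then have "x \<in> V j" using c by (simp add: V_def)
      then show ?thesis unfolding i_def by (rule LeastI)
    qed
    have im[measurable]: "i \<in> measurable M (count_space UNIV)"
      unfolding i_def by measurable
    define H where "H p = indicator A (fst p) * F (a (i (fst p)), snd p)" for p
    have sec[measurable]: "(\<lambda>y. F (a j, y)) \<in> borel_measurable N" for j
      using borel_measurable_continuous_map[OF sN continuous_map_section[OF F a]] .
    have "(\<lambda>p. F (a (i (fst p)), snd p)) \<in> borel_measurable (M \<Otimes>\<^sub>M N)"
      by (rule measurable_compose_countable[where f="\<lambda>j p. F (a j, snd p)" and g="\<lambda>p. i (fst p)"]) measurable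
    then have "H \<in> borel_measurable (M \<Otimes>\<^sub>M N)" unfolding H_def by measurable
    moreover have "\<bar>H p - F p\<bar> < inverse (Suc n)" if p: "p \<in> carrier G \<times> carrier G" for p
    proof -
      obtain x y where xy: "p = (x, y)" "x \<in> carrier G" "y \<in> carrier G" using p by auto
      show ?thesis
      proof (cases "x \<in> A \<and> y \<in> B")
        case True
        then have "x \<in> V (i x)" using i by blast
        then have *: "i x < length xs" "x \<in> U (xs ! i x)" by (auto simp: V_def split: if_splits)
        then have "xs ! i x \<in> A" by (intro xsA)
        then have "\<bar>F (x, y) - F (xs ! i x, y)\<bar> < inverse (Suc n)" using U(3) * True by blast
        then show ?thesis using True * xy by (simp add: H_def a_def abs_minus_commute)
      next
        case False
        then have "F p = 0" "H p = 0" using xy supp a by (auto simp: H_def indicator_def)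
        then show ?thesis by simp
      qed
    qed
    ultimately show ?thesis by blast
  qed
  then obtain H where H: "\<And>n. H n \<in> borel_measurable (M \<Otimes>\<^sub>M N)"
     "\<And>n p. p \<in> carrier G \<times> carrier G \<Longrightarrow> \<bar>H n p - F p\<bar> < inverse (Suc n)" by metis
  show ?thesis
  proof (rule borel_measurable_LIMSEQ_real[OF _ H(1)])
    fix p assume "p \<in> space (M \<Otimes>\<^sub>M N)"
    then have p: "p \<in> carrier G \<times> carrier G" using sM sN by (simp add: space_pair_measure)
    have "(\<lambda>n. H n p - F p) \<longlonglongrightarrow> 0"
      by (rule Lim_null_comparison[OF _ LIMSEQ_inverse_real_of_nat])
        (use H(2)[OF p] in \<open>auto intro!: eventuallyI less_imp_le\<close>)
    then show "(\<lambda>n. H n p) \<longlonglongrightarrow> F p" by (rule LIM_zero_cancel)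
  qed
qed

text \<open>
  Tonelli's theorem needs \<open>\<sigma>\<close>-finite measures, which Haar measures in general are not. Since \<open>F\<close>
  lives on \<open>A \<times> B\<close>, both measures can be cut down to these sets of finite measure.
\<close>

lemma nn_integral_swap_continuous:
  assumes M: "left_haar_measure G M" and N: "left_haar_measure G N"
    and F: "continuous_map (prod_topology T T) euclideanreal F"
    and A: "compactin T A" and B: "compactin T B"
    and supp: "\<And>x y. x \<in> carrier G \<Longrightarrow> y \<in> carrier G \<Longrightarrow> x \<notin> A \<or> y \<notin> B \<Longrightarrow> F (x, y) = 0"
  shows "(\<integral>\<^sup>+x. (\<integral>\<^sup>+y. ennreal (F (x, y)) \<partial>N) \<partial>M) = (\<integral>\<^sup>+y. (\<integral>\<^sup>+x. ennreal (F (x, y)) \<partial>M) \<partial>N)"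
proof -
  note sM = haar_sets[OF M] haar_space[OF M] and sN = haar_sets[OF N] haar_space[OF N]
  have Am[measurable]: "A \<in> sets M" using compact_imp_borel[OF A] sM by simp
  have Bm[measurable]: "B \<in> sets N" using compact_imp_borel[OF B] sN by simp
  define M' where "M' = density M (indicator A)"
  define N' where "N' = density N (indicator B)"
  have s': "sets M' = borel_sets" "space M' = carrier G" "sets N' = borel_sets" "space N' = carrier G"
    using sM sN by (simp_all add: M'_def N'_def)
  interpret M': finite_measure M'
    unfolding M'_def using haar_compact[OF M A] by (intro finite_measure_density_indicator) simp_all
  interpret N': finite_measure N'
    unfolding N'_def using haar_compact[OF N B] by (intro finite_measure_density_indicator) simp_all
  interpret P: pair_sigma_finite M' N' ..
  have Fm: "F \<in> borel_measurable (M' \<Otimes>\<^sub>M N')"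
    by (rule borel_measurable_pair_continuous[OF s' F A B supp])
  then have Fm'[measurable]: "(\<lambda>(x, y). ennreal (F (x, y))) \<in> borel_measurable (M' \<Otimes>\<^sub>M N')"
    by simp
  have "(\<lambda>(y, x). ennreal (F (x, y))) \<in> borel_measurable (N' \<Otimes>\<^sub>M M')"
    using measurable_pair_swap[OF Fm'] by (simp add: case_prod_beta)
  note m2 = M'.borel_measurable_nn_integral[OF this]
  note m1 = N'.borel_measurable_nn_integral[OF Fm']
  have F1: "(\<lambda>y. ennreal (F (x, y))) \<in> borel_measurable N" if "x \<in> carrier G" for x
    using borel_measurable_continuous_map[OF sN continuous_map_section[OF F that]] by simp
  have F2: "(\<lambda>x. ennreal (F (x, y))) \<in> borel_measurable M" if y: "y \<in> carrier G" for y
  proof -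
    have "continuous_map T (prod_topology T T) (\<lambda>x. (x, y))"
      using y by (intro continuous_map_pairedI continuous_group_intros)
    then have "continuous_map T euclideanreal (\<lambda>x. F (x, y))"
      using continuous_map_compose[OF _ F] by (auto simp: o_def)
    from borel_measurable_continuous_map[OF sM this] show ?thesis by simp
  qed
  have i1: "(\<integral>\<^sup>+y. ennreal (F (x, y)) \<partial>N') = (\<integral>\<^sup>+y. ennreal (F (x, y)) \<partial>N)" if x: "x \<in> carrier G" for x
    unfolding N'_def using F1[OF x] supp x
    by (subst nn_integral_density) (auto intro!: nn_integral_cong simp: sN indicator_def)
  have i2: "(\<integral>\<^sup>+x. ennreal (F (x, y)) \<partial>M') = (\<integral>\<^sup>+x. ennreal (F (x, y)) \<partial>M)" if y: "y \<in> carrier G" for y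
    unfolding M'_def using F2[OF y] supp y
    by (subst nn_integral_density) (auto intro!: nn_integral_cong simp: sM indicator_def)
  have "(\<integral>\<^sup>+x. (\<integral>\<^sup>+y. ennreal (F (x, y)) \<partial>N) \<partial>M) = (\<integral>\<^sup>+x. (\<integral>\<^sup>+y. ennreal (F (x, y)) \<partial>N') \<partial>M')"
  proof -
    have "(\<integral>\<^sup>+x. (\<integral>\<^sup>+y. ennreal (F (x, y)) \<partial>N') \<partial>M')
        = (\<integral>\<^sup>+x. indicator A x * (\<integral>\<^sup>+y. ennreal (F (x, y)) \<partial>N') \<partial>M)"
      unfolding M'_def using m1 by (intro nn_integral_density) (auto simp: M'_def)
    also have "\<dots> = (\<integral>\<^sup>+x. (\<integral>\<^sup>+y. ennreal (F (x, y)) \<partial>N) \<partial>M)"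
    proof (rule nn_integral_cong)
      fix x assume "x \<in> space M"
      then have x: "x \<in> carrier G" using sM by simp
      show "indicator A x * (\<integral>\<^sup>+y. ennreal (F (x, y)) \<partial>N') = (\<integral>\<^sup>+y. ennreal (F (x, y)) \<partial>N)"
      proof (cases "x \<in> A")
        case False
        then have "(\<integral>\<^sup>+y. ennreal (F (x, y)) \<partial>N) = (\<integral>\<^sup>+y. 0 \<partial>N)"
          using supp x by (intro nn_integral_cong) (simp add: sN)
        then show ?thesis using False by simp
      qed (simp add: i1[OF x])
    qed
    finally show ?thesis by simp
  qed
  also have "\<dots> = (\<integral>\<^sup>+y. (\<integral>\<^sup>+x. ennreal (F (x, y)) \<partial>M') \<partial>N')"
    using P.Fubini'[OF Fm'] by simp
  also have "\<dots> = (\<integral>\<^sup>+y. indicator B y * (\<integral>\<^sup>+x. ennreal (F (x, y)) \<partial>M') \<partial>N)"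
    unfolding N'_def using m2 by (intro nn_integral_density) (auto simp: N'_def)
  also have "\<dots> = (\<integral>\<^sup>+y. (\<integral>\<^sup>+x. ennreal (F (x, y)) \<partial>M) \<partial>N)"
  proof (rule nn_integral_cong)
    fix y assume "y \<in> space N"
    then have y: "y \<in> carrier G" using sN by simp
    show "indicator B y * (\<integral>\<^sup>+x. ennreal (F (x, y)) \<partial>M') = (\<integral>\<^sup>+x. ennreal (F (x, y)) \<partial>M)"
    proof (cases "y \<in> B")
      case False
      then have "(\<integral>\<^sup>+x. ennreal (F (x, y)) \<partial>M) = (\<integral>\<^sup>+x. 0 \<partial>M)"
        using supp y by (intro nn_integral_cong) (simp add: sM)
      then show ?thesis using False by simp
    qed (simp add: i2[OF y])
  qed
  finally show ?thesis .
qed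

end

section \<open>Uniqueness of Haar measure\<close>

context locally_compact_group
begin

lemma nn_integral_compact_support_finite:
  assumes M: "left_haar_measure G M" and f: "continuous_map T euclideanreal f"
    and C: "compactin T C" and supp: "\<And>x. x \<in> carrier G \<Longrightarrow> x \<notin> C \<Longrightarrow> f x = 0"
  shows "(\<integral>\<^sup>+x. ennreal (f x) \<partial>M) < \<infinity>"
proof -
  have "compact (f ` C)" using image_compactin[OF C f] by simp
  then obtain b where b: "\<And>y. y \<in> f ` C \<Longrightarrow> y \<le> b"
    using compact_imp_bounded bounded_imp_bdd_above unfolding bdd_above_def by metis
  have Cm: "C \<in> sets M" using compact_imp_borel[OF C] by (simp add: haar_sets[OF M])
  have "(\<integral>\<^sup>+x. ennreal (f x) \<partial>M) \<le> (\<integral>\<^sup>+x. ennreal b * indicator C x \<partial>M)"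
    using b supp by (intro nn_integral_mono) (auto simp: haar_space[OF M] indicator_def intro!: ennreal_leI)
  also have "\<dots> = ennreal b * emeasure M C" using Cm by (rule nn_integral_cmult_indicator)
  also have "\<dots> < \<infinity>" using haar_compact[OF M C] by (simp add: ennreal_mult_less_top)
  finally show ?thesis .
qed

lemma continuous_map_realI:
  assumes "\<And>x e. x \<in> carrier G \<Longrightarrow> 0 < e \<Longrightarrow> \<exists>U. openin T U \<and> x \<in> U \<and> (\<forall>y\<in>U. \<bar>g y - g x\<bar> < e)"
  shows "continuous_map T euclideanreal g"
proof -
  have "continuous_map T Met_TC.mtopology g"
    unfolding Met_TC.continuous_map_to_metric
  proof (intro ballI allI impI)
    fix x e assume x: "x \<in> topspace T" and e: "0 < (e::real)"
    then have "x \<in> carrier G" by simp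
    from assms[OF this e] obtain U where "openin T U" "x \<in> U" "\<forall>y\<in>U. \<bar>g y - g x\<bar> < e" by auto
    then show "\<exists>U. openin T U \<and> x \<in> U \<and> (\<forall>y\<in>U. g y \<in> Met_TC.mball (g x) e)"
      by (intro exI[of _ U]) (auto simp: dist_real_def abs_minus_commute)
  qed
  then show ?thesis by simp
qed

text \<open>
  Near \<open>x0\<close> all sections live on one compact set \<open>C\<close>, on which they are uniformly close to the section at
  \<open>x0\<close>; so the integrals differ by at most a small multiple of the measure of \<open>C\<close>.
\<close>

lemma continuous_map_nn_integral:
  assumes N: "left_haar_measure G N"
    and F: "continuous_map (prod_topology T T) euclideanreal F" and F0: "\<And>p. 0 \<le> F p"
    and supp: "\<And>A. compactin T A \<Longrightarrow>
        \<exists>C. compactin T C \<and> (\<forall>x\<in>A. \<forall>y\<in>carrier G - C. F (x, y) = 0)"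
  shows "continuous_map T euclideanreal (\<lambda>x. enn2real (\<integral>\<^sup>+y. ennreal (F (x, y)) \<partial>N))"
    and "x \<in> carrier G \<Longrightarrow> (\<integral>\<^sup>+y. ennreal (F (x, y)) \<partial>N) < \<infinity>"
proof -
  define I where "I x = (\<integral>\<^sup>+y. ennreal (F (x, y)) \<partial>N)" for x
  have fin: "I x < \<infinity>" if x: "x \<in> carrier G" for x
  proof -
    have "compactin T {x}" using x by (simp add: finite_imp_compactin)
    then obtain C where "compactin T C" "\<forall>y\<in>carrier G - C. F (x, y) = 0" using supp by blast
    then show ?thesis
      unfolding I_def by (intro nn_integral_compact_support_finite[OF N continuous_map_section[OF F x]]) auto
  qed
  then show "x \<in> carrier G \<Longrightarrow> (\<integral>\<^sup>+y. ennreal (F (x, y)) \<partial>N) < \<infinity>" unfolding I_def .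
  show "continuous_map T euclideanreal (\<lambda>x. enn2real (\<integral>\<^sup>+y. ennreal (F (x, y)) \<partial>N))"
    unfolding I_def[symmetric]
  proof (rule continuous_map_realI)
    fix x0 and e :: real assume x0: "x0 \<in> carrier G" and e: "0 < e"
    have "compactin T {x0}" using x0 by (simp add: finite_imp_compactin)
    then obtain W L where W: "openin T W" "compactin T L" "{x0} \<subseteq> W" "W \<subseteq> L"
      by (rule compact_in_open_in_compact)
    obtain C where C: "compactin T C" "\<forall>x\<in>L. \<forall>y\<in>carrier G - C. F (x, y) = 0"
      using supp[OF W(2)] by blast
    have Cm[measurable]: "C \<in> sets N" using compact_imp_borel[OF C(1)] by (simp add: haar_sets[OF N])
    define m where "m = enn2real (emeasure N C)"
    have m: "emeasure N C = ennreal m" "0 \<le> m"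
      using haar_compact[OF N C(1)] by (auto simp: m_def less_top)
    \<comment> \<open>Chosen so that changing the section by at most this much on the compact set changes the integral by less than e.\<close>
    define d where "d = e / 2 / (1 + m)"
    have d: "0 < d" using e m by (simp add: d_def)
    have "d * m \<le> d * (1 + m)" using d by simp
    also have "\<dots> = e / 2"
      using m(2) nonzero_eq_divide_eq[of "1 + m" d "e / 2"] by (simp add: d_def)
    also have "\<dots> < e" using e by simp
    finally have dm: "d * m < e" .
    obtain U where U: "openin T U" "x0 \<in> U" "\<And>x y. x \<in> U \<Longrightarrow> y \<in> C \<Longrightarrow> \<bar>F (x, y) - F (x0, y)\<bar> < d"
      using uniformly_near[OF F C(1) x0 d] by metis
    have est: "I x \<le> I x' + ennreal (d * m)"
      if near: "\<And>y. y \<in> C \<Longrightarrow> F (x, y) \<le> F (x', y) + d" and xx: "x \<in> L" "x' \<in> carrier G" for x x'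
    proof -
      have "I x \<le> (\<integral>\<^sup>+y. ennreal (F (x', y)) + ennreal d * indicator C y \<partial>N)"
        unfolding I_def
      proof (rule nn_integral_mono)
        fix y assume "y \<in> space N"
        then have y: "y \<in> carrier G" by (simp add: haar_space[OF N])
        show "ennreal (F (x, y)) \<le> ennreal (F (x', y)) + ennreal d * indicator C y"
        proof (cases "y \<in> C")
          case True
          have "ennreal (F (x, y)) \<le> ennreal (F (x', y) + d)" using near[OF True] by (rule ennreal_leI)
          then show ?thesis using True F0 d by (simp add: ennreal_plus)
        next
          case False
          then show ?thesis using C(2) xx(1) y by simp
        qed
      qed
      also have "\<dots> = I x' + ennreal d * emeasure N C"
        unfolding I_def
        using borel_measurable_continuous_map[OF haar_sets[OF N] haar_space[OF N] continuous_map_section[OF F xx(2)]]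
        by (subst nn_integral_add) (auto simp: nn_integral_cmult_indicator)
      also have "\<dots> = I x' + ennreal (d * m)" using d m by (simp add: ennreal_mult)
      finally show ?thesis .
    qed
    have real: "enn2real (I x) \<le> enn2real (I x') + d * m"
      if "I x \<le> I x' + ennreal (d * m)" "x \<in> carrier G" "x' \<in> carrier G" for x x'
    proof -
      have *: "0 \<le> d * m" using d m by simp
      have "I x' + ennreal (d * m) < \<infinity>" using fin[OF that(3)] by simp
      then have "enn2real (I x) \<le> enn2real (I x' + ennreal (d * m))"
        using that(1) by (intro enn2real_mono) auto
      also have "\<dots> = enn2real (I x') + d * m"
        using fin[OF that(3)] * by (subst enn2real_plus) auto
      finally show ?thesis .
    qed
    show "\<exists>U. openin T U \<and> x0 \<in> U \<and> (\<forall>y\<in>U. \<bar>enn2real (I y) - enn2real (I x0)\<bar> < e)"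
    proof (intro exI[of _ "U \<inter> W"] conjI ballI)
      show "openin T (U \<inter> W)" "x0 \<in> U \<inter> W" using U W by auto
      fix x assume x: "x \<in> U \<inter> W"
      then have xL: "x \<in> L" "x0 \<in> L" "x \<in> carrier G" using W open_subset_carrier[OF W(1)] by auto
      have n: "F (x, y) \<le> F (x0, y) + d" "F (x0, y) \<le> F (x, y) + d" if "y \<in> C" for y
        using U(3)[of x y] that x by auto
      have "enn2real (I x) \<le> enn2real (I x0) + d * m"
        by (rule real[OF est]) (use n xL x0 in auto)
      moreover have "enn2real (I x0) \<le> enn2real (I x) + d * m"
        by (rule real[OF est]) (use n xL x0 in auto)
      ultimately show "\<bar>enn2real (I x) - enn2real (I x0)\<bar> < e" using dm by auto
    qed
  qed
qed

definition compact_support_function :: "('a \<Rightarrow> real) \<Rightarrow> bool" where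
  "compact_support_function f \<longleftrightarrow> continuous_map T euclideanreal f \<and> (\<forall>x. 0 \<le> f x) \<and>
     (\<exists>C. compactin T C \<and> (\<forall>x\<in>carrier G - C. f x = 0))"

lemma continuous_map_pair_compose:
  assumes f: "continuous_map T euclideanreal f"
    and h: "continuous_map (prod_topology T T) T h"
  shows "continuous_map (prod_topology T T) euclideanreal (\<lambda>p. f (h p))"
  using continuous_map_compose[OF h f] by (simp add: o_def)

text \<open>
  Interchange the integrals, substitute \<open>inv y \<otimes> x\<close> for \<open>x\<close> by invariance of \<open>M\<close>, interchange back, and
  substitute \<open>x \<otimes> y\<close> for \<open>y\<close> by invariance of \<open>N\<close>. The integrands of the two interchanges are \<open>F1\<close> and \<open>F2\<close>.
\<close>

lemma convolution_identity:
  assumes M: "left_haar_measure G M" and N: "left_haar_measure G N"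
    and f: "compact_support_function f" and g: "compact_support_function g"
  shows "(\<integral>\<^sup>+x. ennreal (f x) * (\<integral>\<^sup>+y. ennreal (g (y \<otimes> x)) \<partial>N) \<partial>M)
       = (\<integral>\<^sup>+x. ennreal (g x) \<partial>M) * (\<integral>\<^sup>+y. ennreal (f (inv y)) \<partial>N)"
proof -
  note sM = haar_sets[OF M] haar_space[OF M] and sN = haar_sets[OF N] haar_space[OF N]
  obtain A where A: "compactin T A" "\<forall>x\<in>carrier G - A. f x = 0"
    using f unfolding compact_support_function_def by blast
  obtain B where B: "compactin T B" "\<forall>x\<in>carrier G - B. g x = 0"
    using g unfolding compact_support_function_def by blast
  have fc: "continuous_map T euclideanreal f" and f0: "\<And>x. 0 \<le> f x"
    using f unfolding compact_support_function_def by auto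
  have gc: "continuous_map T euclideanreal g" and g0: "\<And>x. 0 \<le> g x"
    using g unfolding compact_support_function_def by auto
  have Ac: "A \<subseteq> carrier G" and Bc: "B \<subseteq> carrier G"
    using A(1) B(1) by (auto dest: compact_subset_carrier)
  define C where "C = (\<lambda>(x, y). x \<otimes> y) ` (B \<times> (\<lambda>x. inv x) ` A)"
  have C: "compactin T C" unfolding C_def by (intro compact_mult compact_inv A B)
  have inC: "b \<otimes> inv a \<in> C" if "b \<in> B" "a \<in> A" for a b using that unfolding C_def by force
  define F1 where "F1 p = f (fst p) * g (snd p \<otimes> fst p)" for p
  define F2 where "F2 p = f (inv (snd p) \<otimes> fst p) * g (fst p)" for p
  have F1c: "continuous_map (prod_topology T T) euclideanreal F1"
    unfolding F1_def
    by (intro continuous_map_real_mult continuous_map_pair_compose[OF fc] continuous_map_pair_compose[OF gc] continuous_group_intros)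
  have F2c: "continuous_map (prod_topology T T) euclideanreal F2"
    unfolding F2_def
    by (intro continuous_map_real_mult continuous_map_pair_compose[OF fc] continuous_map_pair_compose[OF gc] continuous_group_intros)
  have F1s: "F1 (x, y) = 0" if xy: "x \<in> carrier G" "y \<in> carrier G" "x \<notin> A \<or> y \<notin> C" for x y
  proof (rule ccontr)
    assume "F1 (x, y) \<noteq> 0"
    then have "f x \<noteq> 0" "g (y \<otimes> x) \<noteq> 0" by (auto simp: F1_def)
    then have "x \<in> A" "y \<otimes> x \<in> B" using A(2) B(2) xy by auto
    moreover have "y \<otimes> x \<otimes> inv x = y" using xy by (simp add: m_assoc)
    ultimately show False using inC[of "y \<otimes> x" x] xy by simp
  qed
  have F2s: "F2 (x, y) = 0" if xy: "x \<in> carrier G" "y \<in> carrier G" "x \<notin> B \<or> y \<notin> C" for x y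
  proof (rule ccontr)
    assume "F2 (x, y) \<noteq> 0"
    then have "g x \<noteq> 0" "f (inv y \<otimes> x) \<noteq> 0" by (auto simp: F2_def)
    then have "x \<in> B" "inv y \<otimes> x \<in> A" using A(2) B(2) xy by auto
    moreover have "x \<otimes> (inv x \<otimes> y) = y" using xy by (simp add: m_assoc[symmetric])
    then have "x \<otimes> inv (inv y \<otimes> x) = y" using xy by (simp add: inv_mult_group)
    ultimately show False using inC[of x "inv y \<otimes> x"] xy by simp
  qed
  have gm: "(\<lambda>y. ennreal (g (y \<otimes> x))) \<in> borel_measurable N" if x: "x \<in> carrier G" for x
  proof -
    have "continuous_map T T (\<lambda>y. y \<otimes> x)" using x by (intro continuous_group_intros)
    then have "continuous_map T euclideanreal (\<lambda>y. g (y \<otimes> x))"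
      using continuous_map_compose[OF _ gc] by (auto simp: o_def)
    then show ?thesis using borel_measurable_continuous_map[OF sN] by simp
  qed
  have fm: "(\<lambda>y. ennreal (f (inv y \<otimes> x))) \<in> borel_measurable N" if x: "x \<in> carrier G" for x
  proof -
    have "continuous_map T T (\<lambda>y. inv y \<otimes> x)" using x by (intro continuous_group_intros)
    then have "continuous_map T euclideanreal (\<lambda>y. f (inv y \<otimes> x))"
      using continuous_map_compose[OF _ fc] by (auto simp: o_def)
    then show ?thesis using borel_measurable_continuous_map[OF sN] by simp
  qed
  have F2m: "(\<lambda>x. ennreal (F2 (x, y))) \<in> borel_measurable M" if y: "y \<in> carrier G" for y
  proof -
    have "continuous_map T T (\<lambda>x. inv y \<otimes> x)" using y by (intro continuous_group_intros) auto
    then have "continuous_map T euclideanreal (\<lambda>x. f (inv y \<otimes> x) * g x)"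
      using continuous_map_compose[OF _ fc] gc by (intro continuous_map_real_mult) (auto simp: o_def)
    then show ?thesis using borel_measurable_continuous_map[OF sM] by (simp add: F2_def)
  qed
  have "(\<integral>\<^sup>+x. ennreal (f x) * (\<integral>\<^sup>+y. ennreal (g (y \<otimes> x)) \<partial>N) \<partial>M)
      = (\<integral>\<^sup>+x. (\<integral>\<^sup>+y. ennreal (F1 (x, y)) \<partial>N) \<partial>M)"
    using gm f0 g0 by (intro nn_integral_cong) (simp add: sM F1_def ennreal_mult nn_integral_cmult)
  also have "\<dots> = (\<integral>\<^sup>+y. (\<integral>\<^sup>+x. ennreal (F1 (x, y)) \<partial>M) \<partial>N)"
    by (rule nn_integral_swap_continuous[OF M N F1c A(1) C F1s])
  also have "\<dots> = (\<integral>\<^sup>+y. (\<integral>\<^sup>+x. ennreal (F2 (x, y)) \<partial>M) \<partial>N)"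
  proof (rule nn_integral_cong)
    fix y assume "y \<in> space N"
    then have y: "y \<in> carrier G" using sN by simp
    have "(\<integral>\<^sup>+x. ennreal (F2 (x, y)) \<partial>M) = (\<integral>\<^sup>+x. ennreal (F2 (y \<otimes> x, y)) \<partial>M)"
      using nn_integral_left_translate[OF M y F2m[OF y]] by simp
    also have "\<dots> = (\<integral>\<^sup>+x. ennreal (F1 (x, y)) \<partial>M)"
      using y by (intro nn_integral_cong) (simp add: sM F1_def F2_def m_assoc[symmetric])
    finally show "(\<integral>\<^sup>+x. ennreal (F1 (x, y)) \<partial>M) = (\<integral>\<^sup>+x. ennreal (F2 (x, y)) \<partial>M)" by simp
  qed
  also have "\<dots> = (\<integral>\<^sup>+x. (\<integral>\<^sup>+y. ennreal (F2 (x, y)) \<partial>N) \<partial>M)"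
    by (rule nn_integral_swap_continuous[OF M N F2c B(1) C F2s, symmetric])
  also have "\<dots> = (\<integral>\<^sup>+x. ennreal (g x) * (\<integral>\<^sup>+y. ennreal (f (inv y)) \<partial>N) \<partial>M)"
  proof (rule nn_integral_cong)
    fix x assume "x \<in> space M"
    then have x: "x \<in> carrier G" using sM by simp
    have "(\<integral>\<^sup>+y. ennreal (F2 (x, y)) \<partial>N) = ennreal (g x) * (\<integral>\<^sup>+y. ennreal (f (inv y \<otimes> x)) \<partial>N)"
      using fm[OF x] f0 g0 by (simp add: F2_def ennreal_mult mult.commute nn_integral_cmult)
    also have "(\<integral>\<^sup>+y. ennreal (f (inv y \<otimes> x)) \<partial>N) = (\<integral>\<^sup>+y. ennreal (f (inv (x \<otimes> y) \<otimes> x)) \<partial>N)"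
      using nn_integral_left_translate[OF N x fm[OF x]] by simp
    also have "\<dots> = (\<integral>\<^sup>+y. ennreal (f (inv y)) \<partial>N)"
      using x by (intro nn_integral_cong) (simp add: sN inv_mult_group m_assoc)
    finally show "(\<integral>\<^sup>+y. ennreal (F2 (x, y)) \<partial>N) = ennreal (g x) * (\<integral>\<^sup>+y. ennreal (f (inv y)) \<partial>N)" .
  qed
  also have "\<dots> = (\<integral>\<^sup>+x. ennreal (g x) \<partial>M) * (\<integral>\<^sup>+y. ennreal (f (inv y)) \<partial>N)"
    using borel_measurable_continuous_map[OF sM gc] by (intro nn_integral_multc) simp
  finally show ?thesis .
qed

lemma nn_integral_continuous_nonzero:
  assumes M: "left_haar_measure G M" and h: "continuous_map T euclideanreal h" "\<And>x. 0 \<le> h x"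
    and x: "x \<in> carrier G" "h x \<noteq> 0"
  shows "(\<integral>\<^sup>+x. ennreal (h x) \<partial>M) \<noteq> 0"
proof
  assume 0: "(\<integral>\<^sup>+x. ennreal (h x) \<partial>M) = 0"
  have hm: "(\<lambda>x. ennreal (h x)) \<in> borel_measurable M"
    using borel_measurable_continuous_map[OF haar_sets[OF M] haar_space[OF M] h(1)] by simp
  have eq: "{x \<in> space M. ennreal (h x) \<noteq> 0} = {x \<in> carrier G. h x \<in> - {0}}"
    using h(2) by (auto simp: haar_space[OF M])
  have "openin T {x \<in> topspace T. h x \<in> - {0}}"
    by (rule openin_continuous_map_preimage[OF h(1)]) (simp add: open_openin[symmetric] open_Compl)
  moreover have "emeasure M {x \<in> carrier G. h x \<in> - {0}} = 0"
    using 0 nn_integral_0_iff[OF hm] unfolding eq by simp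
  ultimately show False
    using haar_open_nonzero[OF M, of "{x \<in> carrier G. h x \<in> - {0}}"] x by auto
qed

text \<open>
  Let \<open>I x\<close> be the \<open>N\<close>-integral of \<open>g(y x)\<close> over \<open>y\<close>, a positive continuous function. The identity above for
  \<open>f / I\<close> in place of \<open>f\<close> says that the \<open>L\<close>-integral of \<open>f\<close> is that of \<open>g\<close> times a number \<open>J f\<close> that does not
  depend on \<open>L\<close>. Comparing \<open>L = M\<close> with \<open>L = N\<close> gives proportionality.
\<close>

lemma haar_integrals_proportional:
  assumes M: "left_haar_measure G M" and N: "left_haar_measure G N"
  obtains c :: real where "0 < c"
    "\<And>f. compact_support_function f \<Longrightarrow> (\<integral>\<^sup>+x. ennreal (f x) \<partial>M) = ennreal c * (\<integral>\<^sup>+x. ennreal (f x) \<partial>N)"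
proof -
  have "compactin T {\<one>}" by (simp add: finite_imp_compactin)
  then obtain g :: "'a \<Rightarrow> real" and B where gB: "continuous_map T euclideanreal g" "compactin T B"
     "B \<subseteq> carrier G" "\<And>x. 0 \<le> g x" "\<And>x. g x \<le> 1" "\<And>x. x \<in> {\<one>} \<Longrightarrow> g x = 1"
     "\<And>x. x \<notin> carrier G \<Longrightarrow> g x = 0" "\<And>x. x \<notin> B \<Longrightarrow> g x = 0"
    by (rule bump_function[OF _ open_carrier]) (simp, blast)
  then have g: "compact_support_function g" unfolding compact_support_function_def by blast
  have fin: "(\<integral>\<^sup>+x. ennreal (g x) \<partial>L) < \<infinity>" and nz: "(\<integral>\<^sup>+x. ennreal (g x) \<partial>L) \<noteq> 0"
    if L: "left_haar_measure G L" for L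
    using nn_integral_compact_support_finite[OF L gB(1,2)] gB(8)
      nn_integral_continuous_nonzero[OF L gB(1,4), of \<one>] gB(6)[of \<one>] by auto
  define F where "F p = g (snd p \<otimes> fst p)" for p
  define I where "I x = (\<integral>\<^sup>+y. ennreal (F (x, y)) \<partial>N)" for x
  have Fc: "continuous_map (prod_topology T T) euclideanreal F"
    unfolding F_def by (intro continuous_map_pair_compose[OF gB(1)] continuous_group_intros)
  have F0: "0 \<le> F p" for p using gB(4) by (simp add: F_def)
  have supp: "\<exists>C. compactin T C \<and> (\<forall>x\<in>A. \<forall>y\<in>carrier G - C. F (x, y) = 0)" if A: "compactin T A" for A
  proof (intro exI conjI ballI)
    show "compactin T ((\<lambda>(x, y). x \<otimes> y) ` (B \<times> (\<lambda>x. inv x) ` A))" (is "compactin T ?C")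
      by (intro compact_mult compact_inv gB A)
    fix x y assume xy: "x \<in> A" "y \<in> carrier G - ?C"
    then have xc: "x \<in> carrier G" using compact_subset_carrier[OF A] by blast
    show "F (x, y) = 0"
    proof (rule ccontr)
      assume "F (x, y) \<noteq> 0"
      then have "y \<otimes> x \<in> B" using gB(8)[of "y \<otimes> x"] by (auto simp: F_def)
      then have "y \<otimes> x \<otimes> inv x \<in> ?C" using xy(1) by force
      moreover have "y \<otimes> x \<otimes> inv x = y" using xy xc by (simp add: m_assoc)
      ultimately show False using xy by simp
    qed
  qed
  have Gc: "continuous_map T euclideanreal (\<lambda>x. enn2real (I x))"
    unfolding I_def by (rule continuous_map_nn_integral(1)[OF N Fc F0 supp])
  have Ifin: "I x < \<infinity>" if "x \<in> carrier G" for x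
    unfolding I_def by (rule continuous_map_nn_integral(2)[OF N Fc F0 supp that])
  have Inz: "I x \<noteq> 0" if x: "x \<in> carrier G" for x
    unfolding I_def
    by (rule nn_integral_continuous_nonzero[OF N continuous_map_section[OF Fc x], of "inv x"])
      (use x gB(4,6) in \<open>auto simp: F_def\<close>)
  have Ieq: "ennreal (enn2real (I x)) = I x" and Gpos: "0 < enn2real (I x)" if "x \<in> carrier G" for x
    using Ifin[OF that] Inz[OF that] by (auto simp: enn2real_positive_iff zero_less_iff_neq_zero)
  define J where "J f = (\<integral>\<^sup>+y. ennreal (f (inv y) / enn2real (I (inv y))) \<partial>N)" for f
  have key: "(\<integral>\<^sup>+x. ennreal (f x) \<partial>L) = (\<integral>\<^sup>+x. ennreal (g x) \<partial>L) * J f"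
    if L: "left_haar_measure G L" and f: "compact_support_function f" for L f
  proof -
    define f' where "f' x = f x / enn2real (I x)" for x
    have f': "compact_support_function f'"
      unfolding compact_support_function_def
    proof (intro conjI allI)
      show "continuous_map T euclideanreal f'"
        unfolding f'_def using f Gc Gpos
        by (intro continuous_map_real_divide) (force simp: compact_support_function_def)+
      show "0 \<le> f' x" for x using f by (simp add: f'_def compact_support_function_def)
      show "\<exists>C. compactin T C \<and> (\<forall>x\<in>carrier G - C. f' x = 0)"
        using f by (auto simp: f'_def compact_support_function_def)
    qed
    have "(\<integral>\<^sup>+x. ennreal (f x) \<partial>L) = (\<integral>\<^sup>+x. ennreal (f' x) * I x \<partial>L)"
    proof (rule nn_integral_cong)
      fix x assume "x \<in> space L"
      then have x: "x \<in> carrier G" by (simp add: haar_space[OF L])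
      have "ennreal (f' x) * I x = ennreal (f' x) * ennreal (enn2real (I x))" by (simp only: Ieq[OF x])
      also have "\<dots> = ennreal (f' x * enn2real (I x))"
        using f' by (intro ennreal_mult[symmetric]) (auto simp: compact_support_function_def)
      also have "f' x * enn2real (I x) = f x" using Gpos[OF x] by (simp add: f'_def)
      finally show "ennreal (f x) = ennreal (f' x) * I x" by simp
    qed
    also have "\<dots> = (\<integral>\<^sup>+x. ennreal (g x) \<partial>L) * J f"
      using convolution_identity[OF L N f' g] by (simp add: I_def F_def J_def f'_def)
    finally show ?thesis .
  qed
  define a b where "a = enn2real (\<integral>\<^sup>+x. ennreal (g x) \<partial>M)" and "b = enn2real (\<integral>\<^sup>+x. ennreal (g x) \<partial>N)"
  have a: "(\<integral>\<^sup>+x. ennreal (g x) \<partial>M) = ennreal a" "0 < a"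
    using fin[OF M] nz[OF M] by (auto simp: a_def enn2real_positive_iff zero_less_iff_neq_zero)
  have b: "(\<integral>\<^sup>+x. ennreal (g x) \<partial>N) = ennreal b" "0 < b"
    using fin[OF N] nz[OF N] by (auto simp: b_def enn2real_positive_iff zero_less_iff_neq_zero)
  show ?thesis
  proof (rule that[of "a / b"])
    show "0 < a / b" using a b by simp
    fix f assume f: "compact_support_function f"
    have "ennreal (a / b) * (ennreal b * J f) = ennreal (a / b * b) * J f"
      using a(2) b(2) by (subst ennreal_mult) (auto simp only: mult.assoc intro: divide_nonneg_pos less_imp_le)
    also have "\<dots> = ennreal a * J f" using b by simp
    finally show "(\<integral>\<^sup>+x. ennreal (f x) \<partial>M) = ennreal (a / b) * (\<integral>\<^sup>+x. ennreal (f x) \<partial>N)"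
      using key[OF M f] key[OF N f] a b by simp
  qed
qed

text \<open>
  Inner regularity reduces the claim to compact \<open>K \<subseteq> U\<close>, and a bump function squeezed between the
  indicators of \<open>K\<close> and \<open>U\<close> transfers the inequality from integrals to measures.
\<close>

lemma haar_open_le:
  assumes M: "left_haar_measure G M" and N: "left_haar_measure G N"
    and ints: "\<And>f. compact_support_function f \<Longrightarrow>
        (\<integral>\<^sup>+x. ennreal (f x) \<partial>M) = ennreal c * (\<integral>\<^sup>+x. ennreal (f x) \<partial>N)"
    and U: "openin T U"
  shows "emeasure M U \<le> ennreal c * emeasure N U"
  unfolding haar_inner[OF M U]
proof (rule SUP_least)
  fix K assume "K \<in> {K. compactin T K \<and> K \<subseteq> U}"
  then have K: "compactin T K" "K \<subseteq> U" by auto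
  obtain f :: "'a \<Rightarrow> real" and L where f: "continuous_map T euclideanreal f" "compactin T L" "L \<subseteq> carrier G"
    "\<And>x. 0 \<le> f x" "\<And>x. f x \<le> 1" "\<And>x. x \<in> K \<Longrightarrow> f x = 1" "\<And>x. x \<notin> U \<Longrightarrow> f x = 0" "\<And>x. x \<notin> L \<Longrightarrow> f x = 0"
    by (rule bump_function[OF K(1) U K(2)]) blast
  then have cf: "compact_support_function f" unfolding compact_support_function_def by blast
  have "emeasure M K = (\<integral>\<^sup>+x. indicator K x \<partial>M)"
    using compact_imp_borel[OF K(1)] by (simp add: haar_sets[OF M])
  also have "\<dots> \<le> (\<integral>\<^sup>+x. ennreal (f x) \<partial>M)"
    using f(4,6) by (intro nn_integral_mono) (auto simp: indicator_def)
  also have "\<dots> = ennreal c * (\<integral>\<^sup>+x. ennreal (f x) \<partial>N)" by (rule ints[OF cf])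
  also have "(\<integral>\<^sup>+x. ennreal (f x) \<partial>N) \<le> (\<integral>\<^sup>+x. indicator U x \<partial>N)"
    using f(5,7) by (intro nn_integral_mono) (auto simp: indicator_def)
  also have "\<dots> = emeasure N U"
    using open_imp_borel[OF U] by (simp add: haar_sets[OF N])
  finally show "emeasure M K \<le> ennreal c * emeasure N U" by (simp add: mult_left_mono)
qed

lemma haar_borel_le:
  assumes M: "left_haar_measure G M" and N: "left_haar_measure G N"
    and op: "\<And>U. openin T U \<Longrightarrow> ennreal c * emeasure M U \<le> emeasure N U"
    and E: "E \<in> borel_sets"
  shows "ennreal c * emeasure M E \<le> emeasure N E"
  unfolding haar_outer[OF N E]
proof (rule INF_greatest)
  fix U assume "U \<in> {U. openin T U \<and> E \<subseteq> U}"
  then have U: "openin T U" "E \<subseteq> U" by auto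
  have "emeasure M E \<le> emeasure M U"
    using U open_imp_borel by (intro emeasure_mono) (auto simp: haar_sets[OF M])
  then have "ennreal c * emeasure M E \<le> ennreal c * emeasure M U" by (simp add: mult_left_mono)
  also have "\<dots> \<le> emeasure N U" by (rule op[OF U(1)])
  finally show "ennreal c * emeasure M E \<le> emeasure N U" .
qed

theorem haar_measure_unique:
  assumes M: "left_haar_measure G M" and N: "left_haar_measure G N"
  obtains c :: real where "0 < c" "\<And>E. E \<in> borel_sets \<Longrightarrow> emeasure M E = ennreal c * emeasure N E"
proof -
  obtain c :: real where c: "0 < c" and ints: "\<And>f. compact_support_function f \<Longrightarrow>
      (\<integral>\<^sup>+x. ennreal (f x) \<partial>M) = ennreal c * (\<integral>\<^sup>+x. ennreal (f x) \<partial>N)"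
    by (rule haar_integrals_proportional[OF M N]) blast
  have inv: "ennreal (1 / c) * (ennreal c * z) = z" "ennreal c * (ennreal (1 / c) * z) = z" for z
    using c by (simp_all add: mult.assoc[symmetric] ennreal_mult[symmetric])
  have ints': "(\<integral>\<^sup>+x. ennreal (f x) \<partial>N) = ennreal (1 / c) * (\<integral>\<^sup>+x. ennreal (f x) \<partial>M)"
    if "compact_support_function f" for f
    by (simp only: ints[OF that] inv)
  have 1: "ennreal (1 / c) * emeasure M U \<le> emeasure N U" if "openin T U" for U
    using mult_left_mono[OF haar_open_le[OF M N ints that], of "ennreal (1 / c)"] by (simp only: inv) simp
  have 2: "ennreal c * emeasure N U \<le> emeasure M U" if "openin T U" for U
    using mult_left_mono[OF haar_open_le[OF N M ints' that], of "ennreal c"] by (simp only: inv) simp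
  show ?thesis
  proof (rule that[OF c])
    fix E assume E: "E \<in> borel_sets"
    show "emeasure M E = ennreal c * emeasure N E"
    proof (rule antisym)
      show "emeasure M E \<le> ennreal c * emeasure N E"
        using mult_left_mono[OF haar_borel_le[OF M N 1 E], of "ennreal c"] by (simp only: inv) simp
      show "ennreal c * emeasure N E \<le> emeasure M E"
        by (rule haar_borel_le[OF N M 2 E])
    qed
  qed
qed

end

section \<open>The modular function\<close>

context locally_compact_group
begin

lemma haar_measure_exists: "\<exists>M. left_haar_measure G M"
  using haar_content_exists haar_content.left_haar_measure_haar by blast

lemma haar_finite_nonzero:
  assumes M: "left_haar_measure G M"
  obtains U where "openin T U" "emeasure M U \<noteq> 0" "emeasure M U < \<infinity>"
proof -
  obtain U A where UA: "openin T U" "compactin T A" "\<one> \<in> U" "U \<subseteq> A"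
    by (rule compact_neighbourhood_one)
  have "emeasure M U \<le> emeasure M A"
    using UA compact_imp_borel by (intro emeasure_mono) (auto simp: haar_sets[OF M])
  also have "\<dots> < \<infinity>" by (rule haar_compact[OF M UA(2)])
  finally show ?thesis
    using that[OF UA(1)] haar_open_nonzero[OF M UA(1)] UA(3) by auto
qed

text \<open>
  Right translations are homeomorphisms that commute with left translations, so every defining property
  of a left Haar measure carries over to the translated measure.
\<close>

lemma haar_right_translate:
  assumes M: "left_haar_measure G M" and s: "s \<in> carrier G"
  defines "M' \<equiv> distr M M (\<lambda>x. x \<otimes> inv s)"
  shows "E \<in> borel_sets \<Longrightarrow> emeasure M' E = emeasure M (E #> s)"
    and "left_haar_measure G M'"
proof -
  note sM = haar_sets[OF M] haar_space[OF M]
  have s': "sets M' = borel_sets" "space M' = carrier G" by (simp_all add: M'_def sM)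
  have h: "(\<lambda>x. x \<otimes> inv s) \<in> measurable M M"
    using s homeomorphic_imp_continuous_map[OF homeomorphic_right_translation[of "inv s"]]
    by (intro measurable_continuous_map sM) simp
  have em: "emeasure M' E = emeasure M (E #> s)" if E: "E \<in> borel_sets" for E
  proof -
    have "(\<lambda>x. x \<otimes> inv s) -` E \<inter> space M = E #> s"
    proof
      show "(\<lambda>x. x \<otimes> inv s) -` E \<inter> space M \<subseteq> E #> s"
        using r_coset_iff[OF s borel_subset_carrier[OF E]] by (auto simp: sM)
      have "E #> s \<subseteq> carrier G" using s borel_subset_carrier[OF E] by (intro r_coset_subset_G)
      then show "E #> s \<subseteq> (\<lambda>x. x \<otimes> inv s) -` E \<inter> space M"
        using r_coset_iff[OF s borel_subset_carrier[OF E]] by (auto simp: sM)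
    qed
    then show ?thesis using h E by (simp add: M'_def emeasure_distr sM)
  qed
  then show "E \<in> borel_sets \<Longrightarrow> emeasure M' E = emeasure M (E #> s)" .
  have si: "inv s \<in> carrier G" using s by simp
  show "left_haar_measure G M'"
    unfolding left_haar_measure_def s'
  proof (intro conjI allI ballI impI refl)
    have "carrier G #> s \<noteq> {}" using s by (auto simp: r_coset_def)
    then show "emeasure M' (carrier G) \<noteq> 0"
      using haar_open_nonzero[OF M open_r_coset[OF s open_carrier]] em[OF open_imp_borel[OF open_carrier]] by simp
  next
    fix K assume K: "compactin T K"
    show "emeasure M' K < \<infinity>"
      using haar_compact[OF M compact_r_coset[OF s K]] em[OF compact_imp_borel[OF K]] by simp
  next
    fix E assume E: "E \<in> borel_sets"
    have Ec: "E \<subseteq> carrier G" using E by (rule borel_subset_carrier)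
    have "emeasure M' E = (INF V\<in>{V. openin T V \<and> E #> s \<subseteq> V}. emeasure M V)"
      unfolding em[OF E] by (rule haar_outer[OF M borel_r_coset[OF s E]])
    also have "\<dots> = (INF U\<in>{U. openin T U \<and> E \<subseteq> U}. emeasure M' U)"
    proof (rule INF_eq)
      fix V assume "V \<in> {V. openin T V \<and> E #> s \<subseteq> V}"
      then have V: "openin T V" "E #> s \<subseteq> V" by auto
      have "openin T (V #> inv s)" using V si by (intro open_r_coset)
      moreover have "E \<subseteq> V #> inv s"
        using r_coset_mono[OF V(2), of "inv s"] r_coset_inv_cancel(1)[OF s Ec] by simp
      moreover have "emeasure M' (V #> inv s) = emeasure M V"
        using em[OF open_imp_borel[OF calculation(1)]] r_coset_inv_cancel(2)[OF s open_subset_carrier[OF V(1)]] by simp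
      ultimately show "\<exists>U\<in>{U. openin T U \<and> E \<subseteq> U}. emeasure M' U \<le> emeasure M V" by force
    next
      fix U assume "U \<in> {U. openin T U \<and> E \<subseteq> U}"
      then have U: "openin T U" "E \<subseteq> U" by auto
      have "openin T (U #> s)" "E #> s \<subseteq> U #> s"
        using open_r_coset[OF s U(1)] r_coset_mono[OF U(2)] by auto
      then show "\<exists>V\<in>{V. openin T V \<and> E #> s \<subseteq> V}. emeasure M V \<le> emeasure M' U"
        using em[OF open_imp_borel[OF U(1)]] by force
    qed
    finally show "emeasure M' E = (INF U\<in>{U. openin T U \<and> E \<subseteq> U}. emeasure M' U)" .
  next
    fix U assume U: "openin T U"
    have Uc: "U \<subseteq> carrier G" using U by (rule open_subset_carrier)
    have "emeasure M' U = (SUP L\<in>{L. compactin T L \<and> L \<subseteq> U #> s}. emeasure M L)"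
      unfolding em[OF open_imp_borel[OF U]] by (rule haar_inner[OF M open_r_coset[OF s U]])
    also have "\<dots> = (SUP K\<in>{K. compactin T K \<and> K \<subseteq> U}. emeasure M' K)"
    proof (rule SUP_eq)
      fix L assume "L \<in> {L. compactin T L \<and> L \<subseteq> U #> s}"
      then have L: "compactin T L" "L \<subseteq> U #> s" by auto
      have "compactin T (L #> inv s)" using L si by (intro compact_r_coset)
      moreover have "L #> inv s \<subseteq> U"
        using r_coset_mono[OF L(2), of "inv s"] r_coset_inv_cancel(1)[OF s Uc] by simp
      moreover have "emeasure M' (L #> inv s) = emeasure M L"
        using em[OF compact_imp_borel[OF calculation(1)]] r_coset_inv_cancel(2)[OF s compact_subset_carrier[OF L(1)]] by simp
      ultimately show "\<exists>K\<in>{K. compactin T K \<and> K \<subseteq> U}. emeasure M L \<le> emeasure M' K" by force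
    next
      fix K assume "K \<in> {K. compactin T K \<and> K \<subseteq> U}"
      then have K: "compactin T K" "K \<subseteq> U" by auto
      have "compactin T (K #> s)" "K #> s \<subseteq> U #> s"
        using compact_r_coset[OF s K(1)] r_coset_mono[OF K(2)] by auto
      then show "\<exists>L\<in>{L. compactin T L \<and> L \<subseteq> U #> s}. emeasure M' K \<le> emeasure M L"
        using em[OF compact_imp_borel[OF K(1)]] by force
    qed
    finally show "emeasure M' U = (SUP K\<in>{K. compactin T K \<and> K \<subseteq> U}. emeasure M' K)" .
  next
    fix t E assume t: "t \<in> carrier G" and E: "E \<in> borel_sets"
    have "(t <# E) #> s = t <# (E #> s)"
      unfolding l_coset_image r_coset_image image_image
      using borel_subset_carrier[OF E] s t by (intro image_cong refl) (simp add: m_assoc subset_iff)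
    then show "emeasure M' (t <# E) = emeasure M' E"
      using em[OF borel_l_coset[OF t E]] em[OF E] haar_l_coset[OF M t borel_r_coset[OF s E]] by simp
  qed
qed

text \<open>
  By uniqueness, a factor that works for one left Haar measure works for all. It is the only one because
  some open set has positive finite measure.
\<close>

lemma modular_function_eqI:
  assumes M: "left_haar_measure G M" and s: "s \<in> carrier G" and d: "0 < d"
    and scale: "\<And>E. E \<in> borel_sets \<Longrightarrow> emeasure M (E #> s) = ennreal d * emeasure M E"
  shows "modular_function G s = d"
  unfolding modular_function_def
proof (rule the_equality)
  show "0 < d \<and> (\<forall>\<mu>. left_haar_measure G \<mu> \<longrightarrow>
          (\<forall>E\<in>sets \<mu>. emeasure \<mu> (E #> s) = ennreal d * emeasure \<mu> E))"
  proof (intro conjI allI impI ballI d)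
    fix N E assume N: "left_haar_measure G N" and "E \<in> sets N"
    then have E: "E \<in> borel_sets" by (simp add: haar_sets[OF N])
    obtain c :: real where c: "0 < c" "\<And>E. E \<in> borel_sets \<Longrightarrow> emeasure N E = ennreal c * emeasure M E"
      by (rule haar_measure_unique[OF N M]) blast
    show "emeasure N (E #> s) = ennreal d * emeasure N E"
      using c(2)[OF E] c(2)[OF borel_r_coset[OF s E]] scale[OF E] by (simp add: mult.left_commute)
  qed
next
  fix e assume e: "0 < e \<and> (\<forall>\<mu>. left_haar_measure G \<mu> \<longrightarrow>
          (\<forall>E\<in>sets \<mu>. emeasure \<mu> (E #> s) = ennreal e * emeasure \<mu> E))"
  obtain U where U: "openin T U" "emeasure M U \<noteq> 0" "emeasure M U < \<infinity>"
    by (rule haar_finite_nonzero[OF M])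
  have "emeasure M (U #> s) = ennreal e * emeasure M U"
    using e M open_imp_borel[OF U(1)] by (simp add: haar_sets[OF M])
  then have "ennreal e * emeasure M U = ennreal d * emeasure M U"
    using scale[OF open_imp_borel[OF U(1)]] by simp
  moreover obtain u where "emeasure M U = ennreal u" "0 < u"
    using U by (cases "emeasure M U") auto
  ultimately have "ennreal (e * u) = ennreal (d * u)" using e d by (simp add: ennreal_mult)
  then show "e = d" using e d \<open>0 < u\<close> by simp
qed

lemma modular_function_scales:
  assumes s: "s \<in> carrier G"
  shows "0 < modular_function G s"
    and "left_haar_measure G M \<Longrightarrow> E \<in> borel_sets \<Longrightarrow>
          emeasure M (E #> s) = ennreal (modular_function G s) * emeasure M E"
proof -
  have main: "0 < modular_function G s \<and> (\<forall>E\<in>borel_sets.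
      emeasure M (E #> s) = ennreal (modular_function G s) * emeasure M E)"
    if M: "left_haar_measure G M" for M
  proof -
    obtain c :: real where c: "0 < c" "\<And>E. E \<in> borel_sets \<Longrightarrow>
        emeasure (distr M M (\<lambda>x. x \<otimes> inv s)) E = ennreal c * emeasure M E"
      by (rule haar_measure_unique[OF haar_right_translate(2)[OF M s] M]) blast
    then have sc: "emeasure M (E #> s) = ennreal c * emeasure M E" if "E \<in> borel_sets" for E
      using haar_right_translate(1)[OF M s that] that by simp
    have "modular_function G s = c" by (rule modular_function_eqI[OF M s c(1) sc])
    then show ?thesis using c(1) sc by simp
  qed
  then show "0 < modular_function G s" using haar_measure_exists by blast
  show "left_haar_measure G M \<Longrightarrow> E \<in> borel_sets \<Longrightarrow>
          emeasure M (E #> s) = ennreal (modular_function G s) * emeasure M E"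
    using main by blast
qed

lemma modular_function_mult:
  assumes s: "s \<in> carrier G" and t: "t \<in> carrier G"
  shows "modular_function G (s \<otimes> t) = modular_function G s * modular_function G t"
proof -
  obtain M where M: "left_haar_measure G M" using haar_measure_exists by blast
  show ?thesis
  proof (rule modular_function_eqI[OF M])
    show "s \<otimes> t \<in> carrier G" using s t by simp
    show "0 < modular_function G s * modular_function G t"
      using modular_function_scales(1) s t by simp
    fix E assume E: "E \<in> borel_sets"
    have "E #> (s \<otimes> t) = (E #> s) #> t"
      using s t borel_subset_carrier[OF E] by (simp add: coset_mult_assoc)
    then have "emeasure M (E #> (s \<otimes> t)) =
        ennreal (modular_function G t) * (ennreal (modular_function G s) * emeasure M E)"
      using modular_function_scales(2)[OF t M borel_r_coset[OF s E]] modular_function_scales(2)[OF s M E] by simp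
    then show "emeasure M (E #> (s \<otimes> t)) = ennreal (modular_function G s * modular_function G t) * emeasure M E"
      using modular_function_scales(1)[OF s] modular_function_scales(1)[OF t]
      by (simp add: ennreal_mult mult_ac)
  qed
qed

lemma modular_function_one: "modular_function G \<one> = 1"
  using modular_function_mult[of \<one> \<one>] modular_function_scales(1)[of \<one>] by simp

lemma modular_function_inv:
  assumes "s \<in> carrier G" shows "modular_function G s * modular_function G (inv s) = 1"
  using modular_function_mult[of s "inv s"] assms modular_function_one by simp

abbreviation modular_kernel :: "'a set" where
  "modular_kernel \<equiv> {s \<in> carrier G. modular_function G s = 1}"

lemma normal_modular_kernel: "modular_kernel \<lhd> G"
proof (rule normal_inv_iff[THEN iffD2], intro conjI ballI)
  show "subgroup modular_kernel G"
  proof (rule subgroupI)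
    show "modular_kernel \<noteq> {}" using modular_function_one by blast
    show "inv a \<in> modular_kernel" if "a \<in> modular_kernel" for a
      using that modular_function_inv[of a] by simp
  qed (auto simp: modular_function_mult)
  fix x h assume x: "x \<in> carrier G" and h: "h \<in> modular_kernel"
  then show "x \<otimes> h \<otimes> inv x \<in> modular_kernel"
    using modular_function_inv[OF x] by (simp add: modular_function_mult)
qed

end

section \<open>Open subgroups\<close>

locale open_subgroup = locally_compact_group G + subgroup K G
  for K :: "'a set" and G :: "'a top_group" (structure) +
  assumes open_K: "openin T K"
begin

lemma K_carrier: "K \<subseteq> carrier G"
  using subset .

lemma K_nonempty: "K \<noteq> {}"
proof -
  have "subgroup K G" ..
  then show ?thesis using subgroup.one_closed by fastforce
qed

lemma openin_K: "openin (subtopology T K) U \<longleftrightarrow> openin T U \<and> U \<subseteq> K"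
  by (rule openin_open_subtopology[OF open_K])

lemma compactin_K: "compactin (subtopology T K) C \<longleftrightarrow> compactin T C \<and> C \<subseteq> K"
  by (rule compactin_subtopology)

text \<open>
  The complement of an open subgroup is a union of cosets, which are open.
\<close>

lemma closedin_K: "closedin T K"
proof -
  have sub: "subgroup K G" ..
  have "carrier G - K = (\<Union>x\<in>carrier G - K. K #> x)" (is "_ = ?U")
  proof (intro equalityI subsetI)
    fix x assume "x \<in> carrier G - K"
    then show "x \<in> ?U" using rcos_self[OF _ sub, of x] by blast
  next
    fix y assume "y \<in> ?U"
    then obtain x k where x: "x \<in> carrier G" "x \<notin> K" and k: "k \<in> K" "y = k \<otimes> x"
      by (auto simp: r_coset_def)
    have kc: "k \<in> carrier G" using k K_carrier by blast
    have "inv k \<otimes> y = x" using x(1) k(2) kc by (simp add: m_assoc[symmetric])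
    then have "y \<notin> K"
      using x(2) subgroup.m_closed[OF sub subgroup.m_inv_closed[OF sub k(1)]] by metis
    then show "y \<in> carrier G - K" using x(1) k(2) kc by simp
  qed
  moreover have "openin T ?U" using open_r_coset[OF _ open_K] by (intro openin_Union) auto
  ultimately show ?thesis using K_carrier by (simp add: closedin_def)
qed

lemma lc_group_K: "lc_group (top_subgroup G K)"
proof -
  let ?K = "top_subgroup G K"
  have sub: "subgroup K G" ..
  have eqs: "carrier ?K = K" "mult ?K = mult G" "one ?K = one G"
    by (simp_all add: top_subgroup_def)
  have eqs': "carrier (G\<lparr>carrier := K\<rparr>) = K" "mult (G\<lparr>carrier := K\<rparr>) = mult G"
    "one (G\<lparr>carrier := K\<rparr>) = one G" by simp_all
  have "group ?K \<longleftrightarrow> group (G\<lparr>carrier := K\<rparr>)"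
    unfolding group_def group_axioms_def monoid_def Units_def eqs eqs' by (rule refl)
  then have grp: "group ?K"
    using subgroup.subgroup_is_group[OF sub is_group] by blast
  have inv_eq: "inv\<^bsub>?K\<^esub> x = inv x" if "x \<in> K" for x
  proof -
    have "inv\<^bsub>?K\<^esub> x = inv\<^bsub>G\<lparr>carrier := K\<rparr>\<^esub> x"
      unfolding m_inv_def eqs eqs' by (rule refl)
    then show ?thesis using m_inv_consistent[OF sub that] by (rule trans)
  qed
  have top: "topspace (subtopology T K) = K" using K_carrier by auto
  have "continuous_map (subtopology (prod_topology T T) (K \<times> K)) T (\<lambda>(x, y). x \<otimes> y)"
    by (rule continuous_map_from_subtopology[OF continuous_mult])
  then have c1: "continuous_map (prod_topology (subtopology T K) (subtopology T K)) (subtopology T K) (\<lambda>(x, y). x \<otimes> y)"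
    using K_carrier by (auto simp: continuous_map_in_subtopology subtopology_Times[symmetric])
  have "continuous_map (subtopology T K) (subtopology T K) (\<lambda>x. inv x)"
    using K_carrier by (auto simp: continuous_map_in_subtopology intro!: continuous_map_from_subtopology[OF continuous_inv])
  then have c2: "continuous_map (subtopology T K) (subtopology T K) (\<lambda>x. inv\<^bsub>?K\<^esub> x)"
    by (rule continuous_map_eq) (use inv_eq top in auto)
  have tg: "topological_group ?K"
    using grp c1 c2 top unfolding topological_group_def by (simp add: top_subgroup_def)
  have "Hausdorff_space (subtopology T K)" by (rule Hausdorff_space_subtopology[OF Hausdorff_T])
  moreover have "locally_compact_space (subtopology T K)"
    using locally_compact_space_open_subset[of T K] open_K Hausdorff_T locally_compact_T by blast
  ultimately show ?thesis using tg by (simp add: lc_group_def top_subgroup_def)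
qed

lemma sigma_sets_K:
  "sigma_sets K {U. openin (subtopology T K) U} = (\<inter>) K ` borel_sets"
proof -
  have "(\<inter>) K ` borel_sets = sigma_sets K ((\<inter>) K ` {U. openin T U})"
    using open_imp_borel[OF open_K] K_carrier by (rule sigma_sets_Int)
  also have "(\<inter>) K ` {U. openin T U} = {U. openin (subtopology T K) U}"
    using open_K by (auto simp: openin_K intro!: openin_Int image_eqI[where x = U for U])
  finally show ?thesis ..
qed

lemma haar_restrict:
  assumes M: "left_haar_measure G M"
  shows "left_haar_measure (top_subgroup G K) (restrict_space M K)" (is "left_haar_measure ?K ?M")
proof -
  note sM = haar_sets[OF M] haar_space[OF M]
  have sp: "space ?M = K" using K_carrier by (auto simp: space_restrict_space sM)
  have st: "sets ?M = sigma_sets K {U. openin (subtopology T K) U}"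
    by (simp add: sets_restrict_space sigma_sets_K sM)
  have Kb: "K \<in> borel_sets" by (rule open_imp_borel[OF open_K])
  have em: "emeasure ?M E = emeasure M E" if "E \<subseteq> K" for E
    using that Kb K_carrier by (intro emeasure_restrict_space) (simp_all add: sM Int_absorb2)
  have bK: "E \<in> borel_sets \<and> E \<subseteq> K" if "E \<in> sets ?M" for E
    using that Kb sets.Int[of K M] by (auto simp: sets_restrict_space sM)
  have gt: "gtop ?K = subtopology T K" "carrier ?K = K" by (simp_all add: top_subgroup_def)
  have lc: "s <#\<^bsub>?K\<^esub> E = s <# E" for s E by (simp add: l_coset_def top_subgroup_def)
  show ?thesis
    unfolding left_haar_measure_def gt lc
  proof (intro conjI allI ballI impI)
    show "space ?M = K" "sets ?M = sigma_sets K {U. openin (subtopology T K) U}" by fact+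
    show "emeasure ?M K \<noteq> 0"
      using em[OF order_refl] haar_open_nonzero[OF M open_K K_nonempty] by simp
  next
    fix C assume "compactin (subtopology T K) C"
    then show "emeasure ?M C < \<infinity>" using haar_compact[OF M] em by (simp add: compactin_K)
  next
    fix E assume "E \<in> sets ?M"
    then have E: "E \<in> borel_sets" "E \<subseteq> K" using bK by auto
    have "emeasure ?M E = (INF V\<in>{V. openin T V \<and> E \<subseteq> V}. emeasure M V)"
      using em[OF E(2)] haar_outer[OF M E(1)] by simp
    also have "\<dots> = (INF U\<in>{U. openin (subtopology T K) U \<and> E \<subseteq> U}. emeasure ?M U)"
    proof (rule INF_eq)
      fix V assume "V \<in> {V. openin T V \<and> E \<subseteq> V}"
      then have V: "openin T V" "E \<subseteq> V" by auto
      have "emeasure M (V \<inter> K) \<le> emeasure M V"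
        using V by (intro emeasure_mono) (auto simp: sM)
      then show "\<exists>U\<in>{U. openin (subtopology T K) U \<and> E \<subseteq> U}. emeasure ?M U \<le> emeasure M V"
        using V E open_K em[of "V \<inter> K"] by (intro bexI[of _ "V \<inter> K"]) (auto simp: openin_K)
    next
      fix U assume "U \<in> {U. openin (subtopology T K) U \<and> E \<subseteq> U}"
      then show "\<exists>V\<in>{V. openin T V \<and> E \<subseteq> V}. emeasure M V \<le> emeasure ?M U"
        using em[of U] by (intro bexI[of _ U]) (auto simp: openin_K)
    qed
    finally show "emeasure ?M E = (INF U\<in>{U. openin (subtopology T K) U \<and> E \<subseteq> U}. emeasure ?M U)" .
  next
    fix U assume "openin (subtopology T K) U"
    then have U: "openin T U" "U \<subseteq> K" by (auto simp: openin_K)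
    have "emeasure ?M U = (SUP C\<in>{C. compactin T C \<and> C \<subseteq> U}. emeasure M C)"
      using em[OF U(2)] haar_inner[OF M U(1)] by simp
    also have "\<dots> = (SUP C\<in>{C. compactin (subtopology T K) C \<and> C \<subseteq> U}. emeasure ?M C)"
    proof (rule SUP_cong)
      show "{C. compactin T C \<and> C \<subseteq> U} = {C. compactin (subtopology T K) C \<and> C \<subseteq> U}"
        using U(2) by (auto simp: compactin_K)
      show "emeasure M C = emeasure ?M C" if "C \<in> {C. compactin (subtopology T K) C \<and> C \<subseteq> U}" for C
        using that em[of C] by (simp add: compactin_K)
    qed
    finally show "emeasure ?M U = (SUP C\<in>{C. compactin (subtopology T K) C \<and> C \<subseteq> U}. emeasure ?M C)" .
  next
    fix s E assume s: "s \<in> K" and "E \<in> sets ?M"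
    then have E: "E \<in> borel_sets" "E \<subseteq> K" using bK by auto
    have "s <# E \<subseteq> K" using s E(2) by (auto simp: l_coset_def)
    then show "emeasure ?M (s <# E) = emeasure ?M E"
      using em[of "s <# E"] em[OF E(2)] haar_l_coset[OF M mem_carrier[OF s] E(1)] by simp
  qed
qed

lemma modular_function_open_subgroup:
  assumes s: "s \<in> K"
  shows "modular_function (top_subgroup G K) s = modular_function G s"
proof -
  interpret K: locally_compact_group "top_subgroup G K" by unfold_locales (rule lc_group_K)
  obtain M where M: "left_haar_measure G M" using haar_measure_exists by blast
  have sc: "s \<in> carrier G" using s by (rule mem_carrier)
  show ?thesis
  proof (rule K.modular_function_eqI[OF haar_restrict[OF M]])
    show "s \<in> carrier (top_subgroup G K)" using s by (simp add: top_subgroup_def)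
    show "0 < modular_function G s" by (rule modular_function_scales(1)[OF sc])
    fix E assume "E \<in> sigma_sets (carrier (top_subgroup G K)) {U. openin (gtop (top_subgroup G K)) U}"
    then have "E \<in> (\<inter>) K ` borel_sets" by (simp add: top_subgroup_def sigma_sets_K)
    then have E: "E \<in> borel_sets" "E \<subseteq> K"
      using open_imp_borel[OF open_K] sets.Int[of K M] by (auto simp: haar_sets[OF M])
    have Es: "E #>\<^bsub>top_subgroup G K\<^esub> s = E #> s" by (simp add: r_coset_def top_subgroup_def)
    have "E #> s \<subseteq> K" using s E(2) by (auto simp: r_coset_def)
    moreover have "emeasure (restrict_space M K) D = emeasure M D" if "D \<subseteq> K" for D
      using that open_imp_borel[OF open_K] K_carrier
      by (intro emeasure_restrict_space) (simp_all add: haar_sets[OF M] haar_space[OF M] Int_absorb2)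
    ultimately show "emeasure (restrict_space M K) (E #>\<^bsub>top_subgroup G K\<^esub> s)
        = ennreal (modular_function G s) * emeasure (restrict_space M K) E"
      using modular_function_scales(2)[OF sc M E(1)] E(2) by (simp add: Es)
  qed
qed

text \<open>
  The kernel on \<open>G\<close> contains the kernel \<open>D\<close> on \<open>K\<close>, which is open in \<open>G\<close>, and therefore contains the open
  neighbourhood \<open>x <# D\<close> of each of its points \<open>x\<close>.
\<close>

lemma almost_unimodular_if_open_subgroup:
  assumes "almost_unimodular (top_subgroup G K)"
  shows "almost_unimodular G"
proof -
  define D where "D = {s \<in> K. modular_function G s = 1}"
  have "{s \<in> carrier (top_subgroup G K). modular_function (top_subgroup G K) s = 1} = D"
    using modular_function_open_subgroup by (auto simp: D_def top_subgroup_def)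
  then have "openin (subtopology T K) D"
    using assms by (simp add: almost_unimodular_def top_subgroup_def)
  then have D: "openin T D" by (simp add: openin_K)
  have "\<exists>U. openin T U \<and> x \<in> U \<and> U \<subseteq> modular_kernel" if x: "x \<in> modular_kernel" for x
  proof (intro exI conjI)
    have xc: "x \<in> carrier G" using x by simp
    show "openin T (x <# D)" by (rule open_l_coset[OF xc D])
    have "\<one> \<in> D" using modular_function_one by (simp add: D_def)
    then show "x \<in> x <# D" using xc by (force simp: l_coset_def)
    show "x <# D \<subseteq> modular_kernel"
      using x by (auto simp: l_coset_def D_def modular_function_mult)
  qed
  then have "openin T modular_kernel" by (subst openin_subopen) blast
  then show ?thesis using lc_group by (simp add: almost_unimodular_def)
qed

end

section \<open>Discrete quotients\<close>

lemma group_transport: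
  assumes Q: "group Q" and f: "bij_betw f (carrier H) (carrier Q)"
    and mult: "\<And>x y. x \<in> carrier H \<Longrightarrow> y \<in> carrier H \<Longrightarrow>
       x \<otimes>\<^bsub>H\<^esub> y \<in> carrier H \<and> f (x \<otimes>\<^bsub>H\<^esub> y) = f x \<otimes>\<^bsub>Q\<^esub> f y"
    and one: "\<one>\<^bsub>H\<^esub> \<in> carrier H" "f \<one>\<^bsub>H\<^esub> = \<one>\<^bsub>Q\<^esub>"
  shows "group H"
proof -
  interpret Q: group Q by (rule Q)
  have inj: "x = y" if "x \<in> carrier H" "y \<in> carrier H" "f x = f y" for x y
    using f that by (meson bij_betw_def inj_onD)
  have fc: "f x \<in> carrier Q" if "x \<in> carrier H" for x
    using f that by (rule bij_betwE[rule_format])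
  show ?thesis
  proof (rule groupI)
    fix x y z assume x: "x \<in> carrier H" and y: "y \<in> carrier H" and z: "z \<in> carrier H"
    show "x \<otimes>\<^bsub>H\<^esub> y \<in> carrier H" using mult[OF x y] by blast
    have xy: "x \<otimes>\<^bsub>H\<^esub> y \<in> carrier H" and yz: "y \<otimes>\<^bsub>H\<^esub> z \<in> carrier H" using mult x y z by auto
    show "(x \<otimes>\<^bsub>H\<^esub> y) \<otimes>\<^bsub>H\<^esub> z = x \<otimes>\<^bsub>H\<^esub> (y \<otimes>\<^bsub>H\<^esub> z)"
    proof (rule inj)
      show "(x \<otimes>\<^bsub>H\<^esub> y) \<otimes>\<^bsub>H\<^esub> z \<in> carrier H" "x \<otimes>\<^bsub>H\<^esub> (y \<otimes>\<^bsub>H\<^esub> z) \<in> carrier H"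
        using mult xy yz x z by auto
      show "f ((x \<otimes>\<^bsub>H\<^esub> y) \<otimes>\<^bsub>H\<^esub> z) = f (x \<otimes>\<^bsub>H\<^esub> (y \<otimes>\<^bsub>H\<^esub> z))"
        using mult[OF xy z] mult[OF x yz] mult[OF x y] mult[OF y z] fc[OF x] fc[OF y] fc[OF z]
        by (simp add: Q.m_assoc)
    qed
  next
    fix x assume x: "x \<in> carrier H"
    show "\<one>\<^bsub>H\<^esub> \<otimes>\<^bsub>H\<^esub> x = x"
      using mult[OF one(1) x] one(2) fc[OF x] x by (intro inj) auto
    have "inv\<^bsub>Q\<^esub> (f x) \<in> f ` carrier H"
      using f fc[OF x] by (simp add: bij_betw_imp_surj_on)
    then obtain y where y: "y \<in> carrier H" "f y = inv\<^bsub>Q\<^esub> (f x)" by force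
    have "y \<otimes>\<^bsub>H\<^esub> x = \<one>\<^bsub>H\<^esub>"
      using mult[OF y(1) x] y(2) one fc[OF x] by (intro inj) auto
    then show "\<exists>y\<in>carrier H. y \<otimes>\<^bsub>H\<^esub> x = \<one>\<^bsub>H\<^esub>" using y(1) by blast
  qed (rule one(1))
qed

lemma discrete_group_lc_group:
  assumes "group H" "gtop H = discrete_topology (carrier H)"
  shows "lc_group H" "discrete_group H"
proof -
  interpret H: group H by (rule assms(1))
  have "topological_group H"
    unfolding topological_group_def assms(2) prod_topology_discrete_topology[symmetric]
    using assms(1) by auto
  then show "lc_group H" "discrete_group H"
    using assms(2) by (auto simp: lc_group_def discrete_group_def
        Hausdorff_space_discrete_topology locally_compact_space_discrete_topology)
qed

context locally_compact_group
begin

text \<open>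
  The coset \<open>K\<close> is a point of a discrete quotient, and its preimage under the quotient map is \<open>K\<close>.
\<close>

lemma open_if_discrete_quotient:
  assumes K: "K \<lhd> G" and H: "discrete_group H" and f: "f \<in> top_iso H (top_quotient G K)"
  shows "openin T K"
proof -
  interpret K: normal K G by (rule K)
  have sub: "subgroup K G" ..
  have Kc: "K \<subseteq> carrier G" by (rule K.subset)
  have "f \<in> iso H (top_quotient G K)" and hm: "homeomorphic_map (gtop H) (gtop (top_quotient G K)) f"
    using f by (simp_all add: top_iso_def)
  then have surj: "f ` carrier H = rcosets K"
    by (auto simp: iso_def bij_betw_def top_quotient_def FactGroup_def)
  have "K \<in> rcosets K" using K.subgroup_in_rcosets[OF is_group] .
  then obtain x where x: "x \<in> carrier H" "f x = K" using surj by (metis imageE)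
  have "openin (gtop H) {x}" using H x by (simp add: discrete_group_def)
  then have "openin (gtop (top_quotient G K)) (f ` {x})"
    using homeomorphic_imp_open_map[OF hm] unfolding open_map_def by blast
  then have "openin (coset_topology G K) {K}" using x by (simp add: top_quotient_def)
  then have op: "openin T {x \<in> topspace T. K #> x \<in> {K}}"
    by (simp only: openin_coset_topology)
  have "{x \<in> topspace T. K #> x \<in> {K}} = K"
    using coset_join1[OF _ _ sub] coset_join2[OF _ sub] Kc by auto
  then show ?thesis using op by simp
qed

text \<open>
  The quotient itself is a group of sets. The same group is put on a set of coset representatives, so
  that its elements have the type of those of \<open>G\<close>. The quotient topology is discrete because every union of
  cosets of an open subgroup is open.
\<close>

lemma discrete_quotient_model:
  assumes N: "N \<lhd> G" and op: "openin T N"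
  obtains H :: "'a top_group" where "lc_group H" "discrete_group H" "top_iso H (top_quotient G N) \<noteq> {}"
proof -
  interpret N: normal N G by (rule N)
  interpret Q: group "G Mod N" by (rule N.factorgroup_is_group)
  let ?R = "rcosets N"
  define rep where "rep C = (SOME x. x \<in> C)" for C :: "'a set"
  define q where "q x = N #> x" for x
  have sub: "subgroup N G" ..
  have rep: "rep C \<in> C" if C: "C \<in> ?R" for C
  proof -
    obtain a where "a \<in> carrier G" "C = N #> a" using C by (auto simp: RCOSETS_def)
    then have "a \<in> C" using rcos_self[OF _ sub] by simp
    then show ?thesis unfolding rep_def by (rule someI)
  qed
  have repc: "rep C \<in> carrier G" if "C \<in> ?R" for C
    using rep[OF that] that rcosets_part_G[OF sub] by blast
  have qrep: "q (rep C) = C" if C: "C \<in> ?R" for C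
  proof -
    obtain x where x: "x \<in> carrier G" "C = N #> x" using C by (auto simp: RCOSETS_def)
    then have "rep C \<in> N #> x" using rep[OF C] by simp
    then have "N #> x = N #> rep C" by (rule repr_independence[OF _ x(1) sub])
    then show ?thesis using x by (simp add: q_def)
  qed
  have QR: "carrier (G Mod N) = ?R" "mult (G Mod N) = set_mult G" "one (G Mod N) = N"
    by (simp_all add: FactGroup_def)
  define H :: "'a top_group" where
    "H = \<lparr>carrier = rep ` ?R, mult = (\<lambda>x y. rep (q x <#> q y)), one = rep N,
          gtop = discrete_topology (rep ` ?R)\<rparr>"
  have Hsel: "carrier H = rep ` ?R" "mult H = (\<lambda>x y. rep (q x <#> q y))" "one H = rep N"
    "gtop H = discrete_topology (rep ` ?R)" by (simp_all add: H_def)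
  have bij: "bij_betw q (rep ` ?R) ?R"
    by (rule bij_betw_byWitness[of _ rep]) (use qrep in auto)
  have NR: "N \<in> ?R" using Q.one_closed by (simp add: QR)
  have RR: "C <#> D \<in> ?R" if "C \<in> ?R" "D \<in> ?R" for C D
    using Q.m_closed[of C D] that by (simp add: QR)
  have hom: "x \<otimes>\<^bsub>H\<^esub> y \<in> carrier H \<and> q (x \<otimes>\<^bsub>H\<^esub> y) = q x <#> q y"
    if "x \<in> carrier H" "y \<in> carrier H" for x y
  proof -
    have "q x \<in> ?R" "q y \<in> ?R" using that qrep by (auto simp: Hsel)
    then have "q x <#> q y \<in> ?R" by (rule RR)
    then show ?thesis by (simp add: Hsel qrep)
  qed
  have grp: "group H"
  proof (rule group_transport[where f = q])
    show "group (G Mod N)" by (rule Q.is_group)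
    show "bij_betw q (carrier H) (carrier (G Mod N))" using bij by (simp add: Hsel QR)
    show "\<one>\<^bsub>H\<^esub> \<in> carrier H" "q \<one>\<^bsub>H\<^esub> = \<one>\<^bsub>G Mod N\<^esub>" using NR qrep by (simp_all add: Hsel QR)
  qed (use hom in \<open>simp add: QR\<close>)
  have discrete: "coset_topology G N = discrete_topology ?R"
  proof -
    have "openin (coset_topology G N) U" if U: "U \<subseteq> ?R" for U
    proof -
      have cos: "openin T C" if "C \<in> U" for C
        using that U open_r_coset[OF _ op] by (auto simp: RCOSETS_def)
      have "{x \<in> topspace T. N #> x \<in> U} = \<Union>U"
      proof (intro equalityI subsetI)
        fix x assume x: "x \<in> {x \<in> topspace T. N #> x \<in> U}"
        then have "x \<in> N #> x" using rcos_self[OF _ sub] by simp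
        then show "x \<in> \<Union>U" using x by blast
      next
        fix x assume "x \<in> \<Union>U"
        then obtain C where C: "C \<in> U" "x \<in> C" by blast
        then obtain a where a: "a \<in> carrier G" "C = N #> a" using U by (auto simp: RCOSETS_def)
        have "N #> a = N #> x" using C a by (intro repr_independence[OF _ a(1) sub]) simp
        moreover have "x \<in> carrier G" using C(2) open_subset_carrier[OF cos[OF C(1)]] by blast
        ultimately show "x \<in> {x \<in> topspace T. N #> x \<in> U}" using C a by simp
      qed
      then show ?thesis using U cos by (auto simp: openin_coset_topology)
    qed
    moreover have "U \<subseteq> ?R" if "openin (coset_topology G N) U" for U
      using that by (simp add: openin_coset_topology)
    ultimately show ?thesis by (auto simp: topology_eq)
  qed
  have Qsel: "carrier (top_quotient G N) = ?R" "mult (top_quotient G N) = set_mult G"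
    "gtop (top_quotient G N) = discrete_topology ?R"
    by (simp_all add: top_quotient_def QR discrete)
  have "q \<in> iso H (top_quotient G N)"
    using bij hom bij_betwE[OF bij] by (auto simp: iso_def hom_def Hsel(1) Qsel)
  moreover have "homeomorphic_maps (gtop H) (gtop (top_quotient G N)) q rep"
    using qrep by (auto simp: homeomorphic_maps_def Hsel Qsel)
  ultimately have "q \<in> top_iso H (top_quotient G N)"
    by (auto simp: top_iso_def homeomorphic_map_maps)
  moreover have "gtop H = discrete_topology (carrier H)" by (simp add: Hsel)
  ultimately show ?thesis
    using that[of H] discrete_group_lc_group[OF grp] by blast
qed

end

lemma almost_unimodular_discrete_extension:
  assumes G: "lc_group G" and K: "K \<lhd> G" "almost_unimodular (top_subgroup G K)"
    and H: "discrete_group H" "top_iso H (top_quotient G K) \<noteq> {}"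
  shows "almost_unimodular G"
proof -
  interpret locally_compact_group G by unfold_locales (rule G)
  obtain f where "f \<in> top_iso H (top_quotient G K)" using H(2) by blast
  then have "openin T K" by (rule open_if_discrete_quotient[OF K(1) H(1)])
  moreover have "subgroup K G" using K(1) by (simp add: normal_def)
  ultimately interpret open_subgroup K G
    by (intro open_subgroup.intro open_subgroup_axioms.intro locally_compact_group_axioms)
  show ?thesis by (rule almost_unimodular_if_open_subgroup[OF K(2)])
qed

text \<open>
  The subgroup is the kernel of the modular function.
\<close>

lemma almost_unimodular_decomposition:
  fixes G :: "'a top_group"
  assumes G: "almost_unimodular G"
  obtains N and H :: "'a top_group" where "N \<lhd> G" "closedin (gtop G) N" "unimodular (top_subgroup G N)"
    "lc_group H" "discrete_group H" "top_iso H (top_quotient G N) \<noteq> {}"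
proof -
  interpret locally_compact_group G
    by unfold_locales (use G in \<open>simp add: almost_unimodular_def\<close>)
  \<comment> \<open>Opaque, since the simplification rules for subgroup membership loop on a set comprehension.\<close>
  define N where "N = modular_kernel"
  have mem: "s \<in> N \<longleftrightarrow> s \<in> carrier G \<and> modular_function G s = 1" for s
    by (simp add: N_def)
  have op: "openin T N" using G by (simp add: almost_unimodular_def N_def)
  have nrm: "N \<lhd> G" unfolding N_def by (rule normal_modular_kernel)
  have sub: "subgroup N G" using nrm by (simp add: normal_def)
  obtain H :: "'a top_group" where H: "lc_group H" "discrete_group H" "top_iso H (top_quotient G N) \<noteq> {}"
    by (rule discrete_quotient_model[OF nrm op])
  interpret open_subgroup N G
    using op sub by (intro open_subgroup.intro open_subgroup_axioms.intro locally_compact_group_axioms)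
  have "unimodular (top_subgroup G N)"
    unfolding unimodular_def
  proof (intro conjI ballI)
    fix s assume "s \<in> carrier (top_subgroup G N)"
    then have s: "s \<in> N" by (simp add: top_subgroup_def)
    then show "modular_function (top_subgroup G N) s = 1"
      using modular_function_open_subgroup[OF s] mem[of s] by metis
  qed (rule lc_group_K)
  then show ?thesis using that[OF nrm closedin_K _ H] by blast
qed

section \<open>The smallest class closed under discrete extensions\<close>

theorem corollary3p4:
  shows "({G :: 'a top_group. almost_unimodular G} \<subseteq> {G. lc_group G} \<and>
          closed_under_discrete_extensions {G :: 'a top_group. almost_unimodular G} \<and>
          {G :: 'a top_group. unimodular G} \<subseteq> {G. almost_unimodular G}) \<and>
         (\<forall>\<C> :: 'a top_group set.
            \<C> \<subseteq> {G. lc_group G} \<and> closed_under_discrete_extensions \<C> \<and> {G. unimodular G} \<subseteq> \<C>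
            \<longrightarrow> {G. almost_unimodular G} \<subseteq> \<C>)"
proof (intro conjI allI impI subsetI)
  fix G :: "'a top_group" assume "G \<in> {G. almost_unimodular G}"
  then show "G \<in> {G. lc_group G}" by (simp add: almost_unimodular_def)
next
  show "closed_under_discrete_extensions {G :: 'a top_group. almost_unimodular G}"
    unfolding closed_under_discrete_extensions_def
    by (blast intro: almost_unimodular_discrete_extension)
next
  fix G :: "'a top_group" assume "G \<in> {G. unimodular G}"
  then have lc: "lc_group G" and one: "\<forall>s\<in>carrier G. modular_function G s = 1"
    by (simp_all add: unimodular_def)
  have "{s \<in> carrier G. modular_function G s = 1} = topspace (gtop G)"
    using lc one by (auto simp: lc_group_def topological_group_def)
  then show "G \<in> {G. almost_unimodular G}" using lc by (simp add: almost_unimodular_def)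
next
  fix \<C> :: "'a top_group set" and G :: "'a top_group"
  assume \<C>: "\<C> \<subseteq> {G. lc_group G} \<and> closed_under_discrete_extensions \<C> \<and> {G. unimodular G} \<subseteq> \<C>"
    and "G \<in> {G. almost_unimodular G}"
  then have G: "almost_unimodular G" and lc: "lc_group G" by (simp_all add: almost_unimodular_def)
  obtain N and H :: "'a top_group" where NH: "N \<lhd> G" "closedin (gtop G) N" "unimodular (top_subgroup G N)"
    "lc_group H" "discrete_group H" "top_iso H (top_quotient G N) \<noteq> {}"
    by (rule almost_unimodular_decomposition[OF G]) blast
  have "top_subgroup G N \<in> \<C>" using NH(3) \<C> by blast
  then show "G \<in> \<C>"
    using \<C> NH lc unfolding closed_under_discrete_extensions_def by blast
qed

end
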